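(* Let $P$ be the transition matrix of the random walk on a finite connected undirected (possibly weighted) graph $G$, let $s$ be its stationary distribution, and let $\alpha,\beta$ be the spectral quantities of $P$ defined in the context. Let $f$ be a real function on the vertices of $G$ with $\max_i|f(i)|=1$ and $\sum_i f(i)s(i)=0$, and let $V=\sum_i f(i)^2s(i)$. Let $q$ be any probability distribution on the vertices, let $(X_i)_{i\ge 0}$ be the walk with $X_0\sim q$, and let $S_n=\sum_{i=1}^n f(X_i)$. Then for every integer $n\ge 1$ and every real $\gamma>0$, $$\mathbb{P}_q\left(\frac1n S_n>\gamma\right)\le\left\|\frac{q}{\sqrt s}\right\|_2\exp\left(-n\,\frac{1-\beta^2}{1+\beta^2}\cdot\frac{\gamma^2}{4(V+\gamma)}\right)$$ and $$\mathbb{P}_q\left(\frac1n S_n>\gamma\right)\le\exp\left(\frac{1-\alpha}{1+\alpha}\cdot\frac{\gamma^2}{V+\gamma}\right)\left\|\frac{q}{\sqrt s}\right\|_2\exp\left(-n\,\frac{1-\alpha}{1+\alpha}\cdot\frac{\gamma^2}{2(V+\gamma)}\right).$$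
   Context: $G$ is a finite undirected, possibly weighted (with positive edge weights), connected graph with $N$ vertices; random walks on such graphs represent exactly the finite irreducible reversible Markov chains. $P_{ij}$ is the probability of moving from vertex $j$ to vertex $i$ (so the columns of $P$ sum to $1$). $s$ is the unique stationary distribution, $Ps=s$, with $s(i)>0$ for all $i$; reversibility means $s(j)P_{ij}=s(i)P_{ji}$ for all $i,j$. The eigenvalues of $P$ are all real; the top eigenvalue is $1$, it is simple, and all other eigenvalues have absolute value at most $1$. $\alpha<1$ is the maximum of $0$ and the second largest eigenvalue of $P$. $\beta\le 1$ is the second largest absolute value of an eigenvalue of $P$, i.e. the largest absolute value among the eigenvalues other than the simple eigenvalue $1$. $X_0,X_1,\ldots$ is the trajectory of the walk (Markov chain with transition matrix $P$) with starting distribution $q$, and $\mathbb{P}_q$ is the corresponding probability. Expressions in vectors are coordinatewise, so $\left\|\frac{q}{\sqrt s}\right\|_2=\left(\sum_i q(i)^2/s(i)\right)^{1/2}$. *)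

theory Defs
  imports "HOL-Probability.Probability"
begin

(* A weighted graph on the vertex type is given by its weight function; w i j = 0 means that
   there is no edge between i and j.  Loops are allowed, and a loop counts once in the
   degree, so that every irreducible reversible chain on a finite state space arises.
   An unweighted graph has weights in {0, 1}. *)
definition connected_weighted_graph :: "('v::finite \<Rightarrow> 'v \<Rightarrow> real) \<Rightarrow> bool" where
  "connected_weighted_graph w \<longleftrightarrow>
     (\<forall>i j. 0 \<le> w i j) \<and> (\<forall>i j. w i j = w j i) \<and>
     (\<forall>i j. (\<lambda>u v. 0 < w u v)\<^sup>*\<^sup>* i j)"

definition degree_weight :: "('v::finite \<Rightarrow> 'v \<Rightarrow> real) \<Rightarrow> 'v \<Rightarrow> real" where
  "degree_weight w i = (\<Sum>k\<in>UNIV. w i k)"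

(* Column convention: the entry (i, j) is the probability of moving from j to i.
   In a connected graph the only vertex that can have degree 0 is that of the one-vertex graph
   without a loop; division by 0 then gives the zero matrix, which has no stationary
   distribution. *)
definition walk_matrix :: "('v::finite \<Rightarrow> 'v \<Rightarrow> real) \<Rightarrow> real^'v^'v" where
  "walk_matrix w = (\<chi> i j. w j i / degree_weight w j)"

definition prob_vector :: "real^'v::finite \<Rightarrow> bool" where
  "prob_vector q \<longleftrightarrow> (\<forall>i. 0 \<le> q $ i) \<and> (\<Sum>i\<in>UNIV. q $ i) = 1"

definition stationary_distribution :: "real^'v^'v \<Rightarrow> real^'v::finite \<Rightarrow> bool" where
  "stationary_distribution P s \<longleftrightarrow> prob_vector s \<and> P *v s = s"

(* The transition matrix of a reversible chain has only real eigenvalues, so real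
   eigenvectors suffice. *)
definition eigenvalues :: "real^'v^'v::finite \<Rightarrow> real set" where
  "eigenvalues P = {l. \<exists>v. v \<noteq> 0 \<and> P *v v = l *\<^sub>R v}"

(* The top eigenvalue 1 of the walk on a connected graph is simple, so with multiplicities
   counted, removing it once removes it from the set of eigenvalues. *)
definition spec_alpha :: "real^'v^'v::finite \<Rightarrow> real" where
  "spec_alpha P = Max (insert 0 (eigenvalues P - {1}))"

definition spec_beta :: "real^'v^'v::finite \<Rightarrow> real" where
  "spec_beta P = Max (abs ` (eigenvalues P - {1}))"

definition markov_chain ::
  "'a measure \<Rightarrow> (nat \<Rightarrow> 'a \<Rightarrow> 'v::finite) \<Rightarrow> real^'v^'v \<Rightarrow> real^'v \<Rightarrow> bool" where
  "markov_chain M X P q \<longleftrightarrow>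
     prob_space M \<and>
     (\<forall>k. X k \<in> measurable M (count_space UNIV)) \<and>
     (\<forall>i. \<P>(\<omega> in M. X 0 \<omega> = i) = q $ i) \<and>
     (\<forall>m x. \<P>(\<omega> in M. \<forall>k\<le>m. X k \<omega> = x k) > 0 \<longrightarrow>
        \<P>(\<omega> in M. X (Suc m) \<omega> = x (Suc m) \<bar> \<forall>k\<le>m. X k \<omega> = x k) = P $ x (Suc m) $ x m)"

end

theory Submission
  imports Defs
begin

text \<open>Let \<open>D\<close> be the diagonal matrix of \<open>sqrt s\<close>. Reversibility makes \<open>S = D^-1 P D\<close> symmetric, with unit
fixed vector \<open>p = sqrt s\<close>. Write \<open>E\<close> for the diagonal matrix of \<open>exp (r f)\<close> and \<open>u = q / sqrt s\<close>. Then
the moment generating function of \<open>S_n\<close> under \<open>q\<close> is \<open>u \<bullet> (S E)^n p\<close> (lemma \<open>mgf_eq_tilted_power\<close>), so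
Chernoff's inequality reduces everything to bounds on the norm of \<open>(S E)^n p\<close>.

Both bounds rest on one rank-one estimate (\<open>rank_one_bernstein\<close>): with \<open>c = (1 - \<alpha>) / (1 + \<alpha>)\<close>,
\<open>0 < r < c\<close> and \<open>T = exp (V r^2 / (2 (c - r)))\<close>,
\<open>\<alpha> (x \<bullet> x) + (1 - \<alpha>) (x \<bullet> p)^2 \<le> T (x \<bullet> E^-1 x)\<close>.
By Cauchy-Schwarz this follows once a resolvent average of \<open>f\<close> is at most 1; expanding the resolvent as a
geometric series turns that average into moment generating functions of \<open>f\<close> under \<open>s\<close>, which
Bennett's inequality controls.

For \<open>\<beta>\<close>: on the complement of \<open>p\<close> the operator \<open>S^2\<close> is at most \<open>\<beta>^2\<close>, so the estimate, applied with
\<open>\<beta>^2\<close> and \<open>2 r\<close> in place of \<open>\<alpha>\<close> and \<open>r\<close>, bounds the squared norm of \<open>S E\<close> itself.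

For \<open>\<alpha>\<close> only an upper bound on the spectrum of \<open>S\<close> is at hand, and the norm of \<open>S E\<close> can be as large as
\<open>exp r\<close> when \<open>S\<close> has the eigenvalue \<open>- 1\<close>. The symmetric operator \<open>B = E^(1/2) S E^(1/2)\<close> does
satisfy \<open>- T \<le> B \<le> T\<close>: the upper bound is the rank-one estimate, and the lower one follows because
\<open>B\<close> has nonnegative entries. One has \<open>(S E)^(k+1) p = S E^(1/2) z\<close> with \<open>z = B^k z0\<close> and
\<open>z0 = E^(1/2) p\<close>, which leaves one factor \<open>S\<close> without a balancing \<open>E^(1/2)\<close>. Since \<open>S\<close> has spectrum in
\<open>[- 1, \<alpha>]\<close> away from \<open>p\<close>, \<open>S^2 \<le> 2 R - S\<close> for the rank-one majorant \<open>R\<close> of \<open>S\<close>, and hence the squared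
norm is at most \<open>2 T (z \<bullet> z) - z \<bullet> B z\<close>. Each factor \<open>B\<close> multiplies this form by at most \<open>T^2\<close>
(\<open>contraction_form_step\<close>), and at \<open>z0\<close> it is at most \<open>2 T^2 - 1 \<le> T^4\<close>, because \<open>z0 \<bullet> z0 \<le> T\<close> and
\<open>z0 \<bullet> B z0\<close>, the moment generating function of two stationary steps, is at least 1. So the
norm of \<open>(S E)^n p\<close> is at most \<open>T^(n+1)\<close>; the choice \<open>r = c \<gamma> / (V + \<gamma>)\<close>, for which
\<open>T = exp (r \<gamma> / 2)\<close>, gives the claim.\<close>

section \<open>Exponential and resolvent estimates\<close>

text \<open>The quotient \<open>(exp y - 1 - y) / y^2\<close> increases with \<open>y\<close>; this compares its values at \<open>a * x\<close> and \<open>a\<close>.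
For \<open>x \<ge> 0\<close> the power series compare term by term; for \<open>x < 0\<close> both values are compared with \<open>1 / 2\<close>.\<close>

lemma bennett_exp_bound:
  fixes a x :: real
  assumes "0 \<le> a" and "x \<le> 1"
  shows "exp (a * x) \<le> 1 + a * x + x\<^sup>2 * (exp a - 1 - a)"
proof (cases "0 \<le> x")
  case True
  have tail: "(\<lambda>k. inverse (fact (k + 2)) * y ^ (k + 2)) sums (exp y - 1 - y)" for y :: real
  proof -
    have "(\<lambda>k. inverse (fact k) * y ^ k) sums exp y"
      using exp_converges[of y] by (simp add: divide_inverse_commute scaleR_conv_of_real)
    from sums_split_initial_segment[OF this, of 2]
    show ?thesis by (simp add: numeral_2_eq_2 algebra_simps)
  qed
  have "exp (a * x) - 1 - a * x \<le> x\<^sup>2 * (exp a - 1 - a)"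
  proof (rule sums_le[OF _ tail sums_mult[OF tail]])
    fix k :: nat
    have "x ^ (k + 2) \<le> x\<^sup>2 * 1"
      unfolding power_add using True assms(2) power_le_one[of x k]
      by (subst mult.commute) (intro mult_left_mono, auto)
    then show "inverse (fact (k + 2)) * (a * x) ^ (k + 2)
        \<le> x\<^sup>2 * (inverse (fact (k + 2)) * a ^ (k + 2))"
      using mult_left_mono[of "x ^ (k + 2)" "x\<^sup>2" "inverse (fact (k + 2)) * a ^ (k + 2)"] assms(1)
      by (simp add: power_mult_distrib mult_ac del: power_Suc fact_Suc)
  qed
  then show ?thesis by simp
next
  case False
  have neg: "exp y \<le> 1 + y + y\<^sup>2 / 2" if "y \<le> 0" for y :: real
  proof -
    have "1 + 0 + 0\<^sup>2 / 2 - exp 0 \<le> 1 + y + y\<^sup>2 / 2 - exp y"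
    proof (rule DERIV_nonpos_imp_nonincreasing[OF that])
      fix z :: real
      show "\<exists>d. ((\<lambda>y. 1 + y + y\<^sup>2 / 2 - exp y) has_real_derivative d) (at z) \<and> d \<le> 0"
        by (rule exI[of _ "1 + z - exp z"])
          (auto intro!: derivative_eq_intros simp: exp_ge_add_one_self)
    qed
    then show ?thesis by simp
  qed
  have "a * x \<le> 0"
    using False assms(1) by (simp add: mult_nonneg_nonpos)
  then have "exp (a * x) \<le> 1 + a * x + x\<^sup>2 * (a\<^sup>2 / 2)"
    using neg[of "a * x"] by (simp add: power_mult_distrib mult_ac)
  also have "x\<^sup>2 * (a\<^sup>2 / 2) \<le> x\<^sup>2 * (exp a - 1 - a)"
    using exp_lower_Taylor_quadratic[OF assms(1)] by (intro mult_left_mono) auto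
  finally show ?thesis by simp
qed

lemma exp_le_pade:
  fixes r :: real
  assumes "0 \<le> r"
  shows "(2 - r) * exp r \<le> 2 + r"
proof -
  have "2 + 0 - (2 - 0) * exp 0 \<le> 2 + r - (2 - r) * exp r"
  proof (rule DERIV_nonneg_imp_nondecreasing[OF assms])
    fix x :: real
    have "(1 - x) * exp x \<le> exp (- x) * exp x"
      using exp_ge_add_one_self[of "- x"] by (intro mult_right_mono) auto
    then have "0 \<le> 1 - (1 - x) * exp x"
      by (simp flip: exp_add)
    then show "\<exists>d. ((\<lambda>r. 2 + r - (2 - r) * exp r) has_real_derivative d) (at x) \<and> 0 \<le> d"
      by (intro exI[of _ "1 - (1 - x) * exp x"])
        (auto intro!: derivative_eq_intros simp: algebra_simps)
  qed
  then show ?thesis by simp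
qed

text \<open>Replacing \<open>exp r\<close> by the larger \<open>(2 + r) / (2 - r)\<close> turns the first quotient into
\<open>2 * c * r / (2 * c - r)\<close>, and \<open>4 * c * (c - r) \<le> (2 * c - r)\<^sup>2\<close> does the rest. The left-hand
side is the growth rate of the tilted rank-one operator per unit of variance, to first order in the
variance, when \<open>f\<close> takes its value 1 on a set of small measure.\<close>

lemma resolvent_rate:
  fixes \<alpha> r c :: real
  assumes \<alpha>: "0 \<le> \<alpha>" "\<alpha> < 1" and c: "c = (1 - \<alpha>) / (1 + \<alpha>)" and r: "0 < r" "r < c"
  shows "\<alpha> * exp r < 1"
    and "(1 - \<alpha>) * (exp r - 1) / (1 - \<alpha> * exp r) - r \<le> r\<^sup>2 / (2 * (c - r))"
proof -
  have c\<alpha>: "c * (1 + \<alpha>) = 1 - \<alpha>" and "c \<le> 1"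
    using \<alpha> by (simp_all add: c field_simps)
  have r2: "0 < 2 - r" using r \<open>c \<le> 1\<close> by simp
  have num: "(2 - r) * (exp r - 1) \<le> 2 * r"
    using exp_le_pade[of r] r by (simp add: algebra_simps)
  have "\<alpha> * ((2 - r) * exp r) \<le> \<alpha> * (2 + r)"
    using exp_le_pade[of r] r \<alpha> by (intro mult_left_mono) auto
  moreover have "(1 + \<alpha>) * (2 * c - r) = 2 - r - \<alpha> * (2 + r)"
    using c\<alpha> by (simp add: algebra_simps)
  ultimately have den: "(1 + \<alpha>) * (2 * c - r) \<le> (2 - r) * (1 - \<alpha> * exp r)"
    by (simp add: algebra_simps)
  have pos: "0 < (1 + \<alpha>) * (2 * c - r)" using \<alpha> r by simp
  with den r2 have "0 < 1 - \<alpha> * exp r"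
    by (metis less_le_trans zero_less_mult_pos)
  then show 1: "\<alpha> * exp r < 1" by simp
  have "(1 - \<alpha>) * (exp r - 1) / (1 - \<alpha> * exp r)
      = (1 - \<alpha>) * (((2 - r) * (exp r - 1)) / ((2 - r) * (1 - \<alpha> * exp r)))"
    using r2 by simp
  also have "\<dots> \<le> (1 - \<alpha>) * (2 * r / ((1 + \<alpha>) * (2 * c - r)))"
    using num den pos r \<alpha> by (intro mult_left_mono frac_le) auto
  also have "\<dots> = 2 * c * r / (2 * c - r)"
    using \<alpha> r by (simp add: c field_simps)
  also have "\<dots> \<le> r + r\<^sup>2 / (2 * (c - r))"
  proof -
    have "r + r\<^sup>2 / (2 * (c - r)) - 2 * c * r / (2 * c - r)
        = r ^ 3 / (2 * (c - r) * (2 * c - r))"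
      using r by (simp add: field_simps power2_eq_square power3_eq_cube)
    moreover have "0 \<le> r ^ 3 / (2 * (c - r) * (2 * c - r))"
      using r by simp
    ultimately show ?thesis by linarith
  qed
  finally show "(1 - \<alpha>) * (exp r - 1) / (1 - \<alpha> * exp r) - r \<le> r\<^sup>2 / (2 * (c - r))"
    by simp
qed

text \<open>A bound for the top eigenvalue of the tilted operator: its logarithm has the form of Bernstein's
bound on a cumulant generating function, with variance \<open>V / c\<close> and scale \<open>1 / c\<close>, where
\<open>c = (1 - \<alpha>) / (1 + \<alpha>)\<close>.\<close>

definition bernstein_rate :: "real \<Rightarrow> real \<Rightarrow> real \<Rightarrow> real" where
  "bernstein_rate \<alpha> V r = exp (V * (r\<^sup>2 / (2 * ((1 - \<alpha>) / (1 + \<alpha>) - r))))"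

text \<open>A number \<open>T\<close> above all \<open>\<alpha> * exp (r * f i)\<close> dominates the top eigenvalue of a rank-one perturbation of
the diagonal matrix with these entries exactly if the secular function, here the sum below, is at most 1 at \<open>T\<close>.
Each summand is a geometric series in \<open>\<alpha>\<close> whose \<open>k\<close>-th term is a multiple of
\<open>exp ((k + 1) * r * f i)\<close>, so the mean over \<open>s\<close> can be bounded term by term by Bennett's inequality. The
resulting series sum to an expression that is compared with its value at \<open>T = 1\<close>, to which
\<open>resolvent_rate\<close> applies.\<close>

lemma resolvent_mean_le_one:
  fixes s f :: "'v::finite \<Rightarrow> real"
  assumes s: "\<And>i. 0 \<le> s i" "(\<Sum>i\<in>UNIV. s i) = 1"
    and f: "\<And>i. f i \<le> 1" "(\<Sum>i\<in>UNIV. f i * s i) = 0"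
    and V: "V = (\<Sum>i\<in>UNIV. (f i)\<^sup>2 * s i)"
    and \<alpha>: "0 \<le> \<alpha>" "\<alpha> < 1" and r: "0 < r" "r < (1 - \<alpha>) / (1 + \<alpha>)"
    and T: "T = bernstein_rate \<alpha> V r"
  shows "\<alpha> * exp (r * f i) < T"
    and "(1 - \<alpha>) * (\<Sum>i\<in>UNIV. s i * (exp (r * f i) / (T - \<alpha> * exp (r * f i)))) \<le> 1"
proof -
  define c \<kappa> R where "c = (1 - \<alpha>) / (1 + \<alpha>)" and "\<kappa> = r\<^sup>2 / (2 * (c - r))" and "R = exp r"
  have V0: "0 \<le> V" unfolding V using s by (intro sum_nonneg) auto
  have "r < c" using r by (simp add: c_def)
  then have \<kappa>0: "0 \<le> \<kappa>" by (simp add: \<kappa>_def)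
  have T_exp: "T = exp (V * \<kappa>)" by (simp add: T bernstein_rate_def \<kappa>_def c_def)
  have T1: "1 + V * \<kappa> \<le> T" unfolding T_exp by (rule exp_ge_add_one_self)
  then have T1': "1 \<le> T" using mult_nonneg_nonneg[OF V0 \<kappa>0] by simp
  have rate: "\<alpha> * R < 1" "(1 - \<alpha>) * (R - 1) / (1 - \<alpha> * R) - r \<le> \<kappa>"
    using resolvent_rate[OF \<alpha> c_def r(1)] r by (simp_all add: c_def \<kappa>_def R_def)
  have R1: "1 + r \<le> R" unfolding R_def by (rule exp_ge_add_one_self)
  have lt: "\<alpha> * exp (r * f i) < T" for i
  proof -
    have "\<alpha> * exp (r * f i) \<le> \<alpha> * R"
      unfolding R_def using \<alpha> r f(1)[of i] by (intro mult_left_mono) auto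
    with rate(1) T1' show ?thesis by simp
  qed
  then show "\<alpha> * exp (r * f i) < T" .
  have \<alpha>T: "\<alpha> < T" and \<alpha>RT: "\<alpha> * R < T" using \<alpha> T1' rate by simp_all

  have geo: "(\<lambda>k. \<alpha> ^ k * (y / T) ^ Suc k) sums (y / (T - \<alpha> * y))"
    if y: "0 < y" "\<alpha> * y < T" for y
  proof -
    have "norm (\<alpha> * y / T) < 1" using y \<alpha> T1' by simp
    from sums_mult[OF geometric_sums[OF this], of "y / T"]
    show ?thesis using y T1' by (simp add: field_simps power_mult_distrib power_divide)
  qed
  have geo': "(\<lambda>k. \<alpha> ^ k * (1 / T) ^ Suc k * real (Suc k)) sums (T / (T - \<alpha>)\<^sup>2)"
  proof -
    have "norm (\<alpha> / T) < 1" using \<alpha> \<alpha>T T1' by simp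
    from sums_mult[OF geometric_deriv_sums[OF this], of "1 / T"]
    have "(\<lambda>k. 1 / T * (real (Suc k) * (\<alpha> / T) ^ k)) sums (1 / T * (1 / (1 - \<alpha> / T)\<^sup>2))"
      by simp
    moreover have "1 / T * (1 / (1 - \<alpha> / T)\<^sup>2) = T / (T - \<alpha>)\<^sup>2"
      using T1' \<alpha>T by (simp add: field_simps power2_eq_square)
    moreover have "1 / T * (real (Suc k) * (\<alpha> / T) ^ k) = \<alpha> ^ k * (1 / T) ^ Suc k * real (Suc k)" for k
      by (simp add: power_divide)
    ultimately show ?thesis by (simp only:)
  qed
  have mgf: "(\<Sum>i\<in>UNIV. s i * exp (a * f i)) \<le> 1 + V * (exp a - 1 - a)" if "0 \<le> a" for a
  proof -
    have "(\<Sum>i\<in>UNIV. s i * exp (a * f i))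
        \<le> (\<Sum>i\<in>UNIV. s i * (1 + a * f i + (f i)\<^sup>2 * (exp a - 1 - a)))"
      using s f(1) that by (intro sum_mono mult_left_mono bennett_exp_bound) auto
    also have "\<dots> = (\<Sum>i\<in>UNIV. s i) + a * (\<Sum>i\<in>UNIV. f i * s i)
        + (\<Sum>i\<in>UNIV. (f i)\<^sup>2 * s i) * (exp a - 1 - a)"
      by (simp add: algebra_simps sum.distrib sum_subtractf sum_distrib_left sum_distrib_right)
    finally show ?thesis using s(2) f(2) V by simp
  qed
  define A where "A = R / (T - \<alpha> * R) - 1 / (T - \<alpha>) - r * (T / (T - \<alpha>)\<^sup>2)"
  have "(\<Sum>i\<in>UNIV. s i * (exp (r * f i) / (T - \<alpha> * exp (r * f i)))) \<le> 1 / (T - \<alpha>) + V * A"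
  proof (rule sums_le)
    show "(\<lambda>k. \<Sum>i\<in>UNIV. s i * (\<alpha> ^ k * (exp (r * f i) / T) ^ Suc k)) sums
        (\<Sum>i\<in>UNIV. s i * (exp (r * f i) / (T - \<alpha> * exp (r * f i))))"
      by (intro sums_sum sums_mult geo lt) auto
    have "(\<lambda>k. \<alpha> ^ k * (1 / T) ^ Suc k
        + V * (\<alpha> ^ k * (R / T) ^ Suc k - \<alpha> ^ k * (1 / T) ^ Suc k
          - r * (\<alpha> ^ k * (1 / T) ^ Suc k * real (Suc k))))
      sums (1 / (T - \<alpha> * 1) + V * (R / (T - \<alpha> * R) - 1 / (T - \<alpha> * 1) - r * (T / (T - \<alpha>)\<^sup>2)))"
      using \<alpha>T \<alpha>RT by (intro sums_add sums_mult sums_diff geo geo') (auto simp: R_def)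
    then show "(\<lambda>k. \<alpha> ^ k * (1 / T) ^ Suc k
        + V * (\<alpha> ^ k * (R / T) ^ Suc k - \<alpha> ^ k * (1 / T) ^ Suc k
          - r * (\<alpha> ^ k * (1 / T) ^ Suc k * real (Suc k)))) sums (1 / (T - \<alpha>) + V * A)"
      by (simp add: A_def)
    fix k
    have e: "exp (r * x) ^ Suc k = exp (real (Suc k) * r * x)" for x
      by (simp only: exp_of_nat_mult[symmetric] mult_ac)
    have "(\<Sum>i\<in>UNIV. s i * (\<alpha> ^ k * (exp (r * f i) / T) ^ Suc k))
        = \<alpha> ^ k * (1 / T) ^ Suc k * (\<Sum>i\<in>UNIV. s i * exp (real (Suc k) * r * f i))"
      unfolding power_divide e sum_distrib_left by (intro sum.cong) (auto simp: field_simps)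
    also have "\<dots> \<le> \<alpha> ^ k * (1 / T) ^ Suc k
        * (1 + V * (exp (real (Suc k) * r) - 1 - real (Suc k) * r))"
      using \<alpha> T1' r by (intro mult_left_mono mgf) auto
    also have "\<dots> = \<alpha> ^ k * (1 / T) ^ Suc k
        + V * (\<alpha> ^ k * (R / T) ^ Suc k - \<alpha> ^ k * (1 / T) ^ Suc k
          - r * (\<alpha> ^ k * (1 / T) ^ Suc k * real (Suc k)))"
      using T1' e[of 1] by (simp add: R_def power_divide divide_simps del: power_Suc)
        (simp add: algebra_simps)
    finally show "(\<Sum>i\<in>UNIV. s i * (\<alpha> ^ k * (exp (r * f i) / T) ^ Suc k)) \<le> \<dots>" .
  qed
  then have "(1 - \<alpha>) * (\<Sum>i\<in>UNIV. s i * (exp (r * f i) / (T - \<alpha> * exp (r * f i))))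
      \<le> (1 - \<alpha>) * (1 / (T - \<alpha>) + V * A)"
    using \<alpha> by (intro mult_left_mono) auto
  also have "\<dots> \<le> 1"
  proof -
    \<comment> \<open>\<open>(1 - \<alpha>) * K T\<close> is the cost per unit of variance; it decreases in \<open>T\<close>, and at \<open>T = 1\<close> it is the quantity that \<open>\<kappa>\<close> bounds\<close>
    define K where "K t = (R - 1) * (t / (t - \<alpha> * R)) - r * (t / (t - \<alpha>))" for t
    have "K T \<le> K 1"
    proof -
      have "t / (t - b) = 1 + b / (t - b)" if "b < t" for t b :: real
        using that by (simp add: field_simps)
      note frac = this[of "\<alpha> * R"] this[of \<alpha>]
      have "\<alpha> / (1 - \<alpha>) - \<alpha> / (T - \<alpha>) = (T - 1) * (\<alpha> / ((1 - \<alpha>) * (T - \<alpha>)))"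
        using \<alpha> \<alpha>T by (simp add: field_simps)
      also have "\<dots> \<le> (T - 1) * (\<alpha> * R / ((1 - \<alpha> * R) * (T - \<alpha> * R)))"
      proof (intro mult_left_mono frac_le mult_mono)
        have "\<alpha> * 1 \<le> \<alpha> * R" using \<alpha> R1 r by (intro mult_left_mono) auto
        then show "\<alpha> \<le> \<alpha> * R" "1 - \<alpha> * R \<le> 1 - \<alpha>" "T - \<alpha> * R \<le> T - \<alpha>" by auto
      qed (use \<alpha> \<alpha>T \<alpha>RT rate T1' R1 r in auto)
      also have "\<dots> = \<alpha> * R / (1 - \<alpha> * R) - \<alpha> * R / (T - \<alpha> * R)"
        using rate \<alpha>RT by (simp add: field_simps)
      finally have mono: "\<alpha> / (1 - \<alpha>) - \<alpha> / (T - \<alpha>) \<le> \<dots>" .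
      have "r * (\<alpha> / (1 - \<alpha>) - \<alpha> / (T - \<alpha>)) \<le> (R - 1) * (\<alpha> * R / (1 - \<alpha> * R) - \<alpha> * R / (T - \<alpha> * R))"
      proof (rule mult_mono[OF _ mono])
        show "0 \<le> \<alpha> / (1 - \<alpha>) - \<alpha> / (T - \<alpha>)"
          using \<alpha> T1' by (simp add: frac_le)
      qed (use R1 r in auto)
      moreover have K: "K t = (R - 1) * (1 + \<alpha> * R / (t - \<alpha> * R)) - r * (1 + \<alpha> / (t - \<alpha>))"
        if "\<alpha> * R < t" "\<alpha> < t" for t
        unfolding K_def frac(1)[OF that(1)] frac(2)[OF that(2)] ..
      ultimately show ?thesis
        unfolding K[OF rate(1) \<alpha>(2)] K[OF \<alpha>RT \<alpha>T] by (simp only: ring_distribs)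
    qed
    moreover have "(1 - \<alpha>) * K 1 \<le> \<kappa>"
      using rate \<alpha> by (simp add: K_def right_diff_distrib)
    ultimately have "(1 - \<alpha>) * K T \<le> \<kappa>"
      using \<alpha> order_trans[OF mult_left_mono[of "K T" "K 1" "1 - \<alpha>"]] by simp
    then have "V * ((1 - \<alpha>) * K T) \<le> T - 1"
      using V0 T1 mult_left_mono[of "(1 - \<alpha>) * K T" \<kappa> V] by simp
    moreover have A: "A = K T / (T - \<alpha>)"
      using \<alpha>T \<alpha>RT unfolding A_def K_def by (simp add: divide_simps) (simp add: algebra_simps power2_eq_square)
    have "(1 - \<alpha>) * (1 / (T - \<alpha>) + V * A) = ((1 - \<alpha>) + V * ((1 - \<alpha>) * K T)) / (T - \<alpha>)"
      unfolding A by (simp add: divide_inverse algebra_simps)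
    ultimately show ?thesis using \<alpha>T by simp
  qed
  finally show "(1 - \<alpha>) * (\<Sum>i\<in>UNIV. s i * (exp (r * f i) / (T - \<alpha> * exp (r * f i)))) \<le> 1" .
qed

text \<open>Cauchy-Schwarz with weights for which one factor is the mean bounded by \<open>resolvent_mean_le_one\<close> and
the other is the right-hand side minus the term with \<open>\<alpha>\<close>.\<close>

lemma rank_one_bernstein:
  fixes s f x :: "'v::finite \<Rightarrow> real"
  assumes s: "\<And>i. 0 \<le> s i" "(\<Sum>i\<in>UNIV. s i) = 1"
    and f: "\<And>i. f i \<le> 1" "(\<Sum>i\<in>UNIV. f i * s i) = 0"
    and V: "V = (\<Sum>i\<in>UNIV. (f i)\<^sup>2 * s i)"
    and \<alpha>: "0 \<le> \<alpha>" "\<alpha> < 1" and r: "0 < r" "r < (1 - \<alpha>) / (1 + \<alpha>)"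
  shows "\<alpha> * (\<Sum>i\<in>UNIV. (x i)\<^sup>2) + (1 - \<alpha>) * (\<Sum>i\<in>UNIV. sqrt (s i) * x i)\<^sup>2
    \<le> bernstein_rate \<alpha> V r * (\<Sum>i\<in>UNIV. exp (- (r * f i)) * (x i)\<^sup>2)"
proof -
  define T where "T = bernstein_rate \<alpha> V r"
  define e where "e i = exp (r * f i)" for i
  have e0: "0 < e i" for i by (simp add: e_def)
  have lt: "\<alpha> * e i < T" for i
    using resolvent_mean_le_one(1)[OF s f V \<alpha> r T_def] by (simp add: e_def)
  define a b where "a i = sqrt (s i * (e i / (T - \<alpha> * e i)))"
    and "b i = sqrt ((T - \<alpha> * e i) / e i) * x i" for i
  have "(\<Sum>i\<in>UNIV. sqrt (s i) * x i)\<^sup>2 = (\<Sum>i\<in>UNIV. a i * b i)\<^sup>2"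
  proof -
    have "a i * b i = sqrt (s i) * x i" for i
      using e0[of i] lt[of i] by (simp add: a_def b_def real_sqrt_mult real_sqrt_divide)
    then show ?thesis by simp
  qed
  also have "\<dots> \<le> (\<Sum>i\<in>UNIV. (a i)\<^sup>2) * (\<Sum>i\<in>UNIV. (b i)\<^sup>2)"
    by (rule Cauchy_Schwarz_ineq_sum)
  also have "(\<Sum>i\<in>UNIV. (a i)\<^sup>2) = (\<Sum>i\<in>UNIV. s i * (e i / (T - \<alpha> * e i)))"
    using e0 lt s(1) by (intro sum.cong) (auto simp: a_def less_imp_le)
  finally have "(1 - \<alpha>) * (\<Sum>i\<in>UNIV. sqrt (s i) * x i)\<^sup>2
      \<le> (1 - \<alpha>) * (\<Sum>i\<in>UNIV. s i * (e i / (T - \<alpha> * e i))) * (\<Sum>i\<in>UNIV. (b i)\<^sup>2)"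
    using \<alpha> by (simp add: mult_left_mono mult.assoc)
  also have "\<dots> \<le> 1 * (\<Sum>i\<in>UNIV. (b i)\<^sup>2)"
    using resolvent_mean_le_one(2)[OF s f V \<alpha> r T_def]
    by (intro mult_right_mono sum_nonneg) (auto simp: e_def)
  also have "\<dots> = (\<Sum>i\<in>UNIV. T * (exp (- (r * f i)) * (x i)\<^sup>2) - \<alpha> * (x i)\<^sup>2)"
  proof -
    have "(b i)\<^sup>2 = T * (exp (- (r * f i)) * (x i)\<^sup>2) - \<alpha> * (x i)\<^sup>2" for i
      using e0[of i] lt[of i]
      by (simp add: b_def power_mult_distrib less_imp_le exp_minus flip: e_def) (simp add: field_simps)
    then show ?thesis by simp
  qed
  also have "\<dots> = T * (\<Sum>i\<in>UNIV. exp (- (r * f i)) * (x i)\<^sup>2) - \<alpha> * (\<Sum>i\<in>UNIV. (x i)\<^sup>2)"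
    by (simp add: sum_subtractf sum_distrib_left)
  finally show ?thesis by (simp add: T_def)
qed

section \<open>Self-adjoint operators on Euclidean spaces\<close>

definition self_adjoint :: "('a::real_inner \<Rightarrow> 'a) \<Rightarrow> bool" where
  "self_adjoint A \<longleftrightarrow> linear A \<and> (\<forall>x y. A x \<bullet> y = x \<bullet> A y)"

lemma self_adjointD:
  assumes "self_adjoint A"
  shows "linear A" "A x \<bullet> y = x \<bullet> A y"
  using assms by (auto simp: self_adjoint_def)

text \<open>A maximiser of the quadratic form on the unit sphere of \<open>W\<close> exists by compactness, and it is an
eigenvector because a nonzero residual would be a direction of first-order increase.\<close>

lemma exists_top_eigenvector:
  fixes A :: "'a::euclidean_space \<Rightarrow> 'a"
  assumes A: "self_adjoint A" and W: "subspace W" "\<And>x. x \<in> W \<Longrightarrow> A x \<in> W"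
    and ne: "W \<noteq> {0}"
  obtains v \<mu> where "v \<in> W" "v \<noteq> 0" "A v = \<mu> *\<^sub>R v" "\<And>x. x \<in> W \<Longrightarrow> x \<bullet> A x \<le> \<mu> * (x \<bullet> x)"
proof -
  note lin = self_adjointD(1)[OF A] and sym = self_adjointD(2)[OF A]
  note [simp] = linear_add[OF lin] linear_diff[OF lin] linear_cmul[OF lin]
  obtain w where w: "w \<in> W" "w \<noteq> 0"
    using ne subspace_0[OF W(1)] by auto
  have "compact (W \<inter> sphere 0 1)"
    using closed_subspace[OF W(1)] by (intro closed_Int_compact) auto
  moreover have "(1 / norm w) *\<^sub>R w \<in> W \<inter> sphere 0 1"
    using w subspace_scale[OF W(1)] by simp
  then have "W \<inter> sphere 0 1 \<noteq> {}" by blast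
  moreover have "continuous_on (W \<inter> sphere 0 1) (\<lambda>x. x \<bullet> A x)"
    by (intro continuous_intros linear_continuous_on linear_conv_bounded_linear[THEN iffD1] lin)
  ultimately obtain v where "v \<in> W \<inter> sphere 0 1"
      and "\<forall>x \<in> W \<inter> sphere 0 1. x \<bullet> A x \<le> v \<bullet> A v"
    using continuous_attains_sup[of "W \<inter> sphere 0 1" "\<lambda>x. x \<bullet> A x"] by blast
  then have v: "v \<in> W" "norm v = 1"
      and max: "\<And>x. x \<in> W \<Longrightarrow> norm x = 1 \<Longrightarrow> x \<bullet> A x \<le> v \<bullet> A v"
    by auto
  define \<mu> where "\<mu> = v \<bullet> A v"
  have le: "x \<bullet> A x \<le> \<mu> * (x \<bullet> x)" if "x \<in> W" for x
  proof (cases "x = 0")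
    case False
    have "((1 / norm x) *\<^sub>R x) \<bullet> A ((1 / norm x) *\<^sub>R x) \<le> \<mu>"
      unfolding \<mu>_def using False that subspace_scale[OF W(1)] by (intro max) auto
    then show ?thesis
      using False by (simp add: power2_norm_eq_inner[symmetric] field_simps power2_eq_square)
  qed (simp add: linear_0[OF lin])
  define g where "g = A v - \<mu> *\<^sub>R v"
  have g: "g \<in> W" unfolding g_def using v W by (intro subspace_diff subspace_scale) auto
  have vv: "v \<bullet> v = 1" using v(2) by (simp add: norm_eq_1)
  have "g = 0"
  proof (rule ccontr)
    assume "g \<noteq> 0"
    then have gg: "0 < g \<bullet> g" by simp
    \<comment> \<open>the step from \<open>v\<close> to \<open>v + t *\<^sub>R g\<close> gains \<open>2 * t * (g \<bullet> g)\<close> and loses \<open>t\<^sup>2 * q\<close>; this \<open>t\<close> keeps \<open>t * q\<close> below \<open>g \<bullet> g\<close>\<close>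
    define q t where "q = \<mu> * (g \<bullet> g) - g \<bullet> A g" and "t = g \<bullet> g / (1 + q)"
    have q0: "0 \<le> q" using le[OF g] by (simp add: q_def)
    have t0: "0 < t" unfolding t_def using gg q0 by simp
    have "v + t *\<^sub>R g \<in> W" using v g W by (intro subspace_add subspace_scale) auto
    from le[OF this] have "2 * t * (g \<bullet> A v - \<mu> * (v \<bullet> g)) \<le> t\<^sup>2 * q"
      using sym[of v g] vv by (simp add: inner_add inner_commute[of g v] \<mu>_def[symmetric] q_def algebra_simps power2_eq_square)
        (simp add: inner_commute)
    moreover have "g \<bullet> A v - \<mu> * (v \<bullet> g) = g \<bullet> g"
    proof -
      have "g \<bullet> g = g \<bullet> (A v - \<mu> *\<^sub>R v)" by (simp add: g_def)
      then show ?thesis by (simp add: inner_diff inner_commute)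
    qed
    ultimately have "t * (2 * (g \<bullet> g)) \<le> t * (t * q)"
      by (simp add: power2_eq_square mult_ac)
    then have "2 * (g \<bullet> g) \<le> t * q" using t0 by simp
    also have "t * q \<le> g \<bullet> g"
      unfolding t_def using gg q0 by (simp add: field_simps)
    finally show False using gg by simp
  qed
  then show thesis
    using that[of v \<mu>, OF v(1) _ _ le] v(2) by (fastforce simp: g_def)
qed

text \<open>The claim is \<open>(a - A) (A + b) \<ge> 0\<close>. The factors are nonnegative and commute, and
\<open>(a + b) (a - A) (A + b) = (a - A) (A + b) (a - A) + (A + b) (a - A) (A + b)\<close>, where each
summand on the right is the conjugate of a nonnegative operator.\<close>

lemma square_form_le:
  assumes A: "self_adjoint A" and W: "subspace W" "\<And>x. x \<in> W \<Longrightarrow> A x \<in> W"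
    and upper: "\<And>x. x \<in> W \<Longrightarrow> x \<bullet> A x \<le> a * (x \<bullet> x)"
    and lower: "\<And>x. x \<in> W \<Longrightarrow> - (b * (x \<bullet> x)) \<le> x \<bullet> A x"
    and ab: "0 < a + b" and x: "x \<in> W"
  shows "A x \<bullet> A x \<le> (a - b) * (x \<bullet> A x) + a * b * (x \<bullet> x)"
proof -
  note lin = self_adjointD(1)[OF A] and sym = self_adjointD(2)[OF A]
  note [simp] = linear_add[OF lin] linear_diff[OF lin] linear_cmul[OF lin]
  define u v where "u = a *\<^sub>R x - A x" and "v = b *\<^sub>R x + A x"
  have uv: "u \<in> W" "v \<in> W"
    unfolding u_def v_def using x W by (auto intro!: subspace_diff subspace_add subspace_scale)
  have "0 \<le> (u \<bullet> A u + b * (u \<bullet> u)) + (a * (v \<bullet> v) - v \<bullet> A v)"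
    using upper[OF uv(2)] lower[OF uv(1)] by simp
  also have "\<dots> = (a + b) * ((a - b) * (x \<bullet> A x) + a * b * (x \<bullet> x) - A x \<bullet> A x)"
    unfolding u_def v_def using sym[of x "A x"] sym[of x x]
    by (simp add: inner_add inner_diff algebra_simps)
  finally show ?thesis using ab by (simp add: zero_le_mult_iff)
qed

text \<open>This is \<open>square_form_le\<close> with \<open>b = a\<close>; the limit of \<open>a + e\<close> covers \<open>a = 0\<close>.\<close>

lemma norm_le_of_form_le:
  assumes A: "self_adjoint A" and W: "subspace W" "\<And>x. x \<in> W \<Longrightarrow> A x \<in> W"
    and bound: "\<And>x. x \<in> W \<Longrightarrow> \<bar>x \<bullet> A x\<bar> \<le> a * (x \<bullet> x)"
    and x: "x \<in> W"
  shows "A x \<bullet> A x \<le> a\<^sup>2 * (x \<bullet> x)"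
proof (cases "x = 0")
  case True
  then show ?thesis by (simp add: linear_0[OF self_adjointD(1)[OF A]])
next
  case False
  then have "0 \<le> a" using bound[OF x] by (metis abs_ge_zero inner_gt_zero_iff order_trans zero_le_mult_iff not_less)
  have *: "A x \<bullet> A x \<le> (a + e)\<^sup>2 * (x \<bullet> x)" if "0 < e" for e
  proof -
    have "\<bar>y \<bullet> A y\<bar> \<le> (a + e) * (y \<bullet> y)" if "y \<in> W" for y
      using order_trans[OF bound[OF that], of "(a + e) * (y \<bullet> y)"] \<open>0 < e\<close> by (simp add: distrib_right)
    then have "y \<bullet> A y \<le> (a + e) * (y \<bullet> y)" "- ((a + e) * (y \<bullet> y)) \<le> y \<bullet> A y" if "y \<in> W" for y
      using \<open>\<And>y. y \<in> W \<Longrightarrow> \<bar>y \<bullet> A y\<bar> \<le> (a + e) * (y \<bullet> y)\<close>[OF that]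
      by linarith+
    from square_form_le[OF A W this _ x] show ?thesis
      using \<open>0 \<le> a\<close> \<open>0 < e\<close> by (simp add: power2_eq_square)
  qed
  show ?thesis
  proof (rule tendsto_lowerbound)
    show "((\<lambda>e. (a + e)\<^sup>2 * (x \<bullet> x)) \<longlongrightarrow> a\<^sup>2 * (x \<bullet> x)) (at_right 0)"
      by (auto intro!: tendsto_eq_intros)
    show "\<forall>\<^sub>F e in at_right 0. A x \<bullet> A x \<le> (a + e)\<^sup>2 * (x \<bullet> x)"
      using * by (auto simp: eventually_at_right_less eventually_at_filter intro!: always_eventually)
  qed simp
qed

text \<open>For \<open>- T \<le> B \<le> T\<close> the difference of the two sides is
\<open>(T - B) (T + B) (2 T - B) = T (T^2 - B^2) + (T - B) (T + B) (T - B)\<close>, evaluated at \<open>z\<close>.\<close>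

lemma contraction_form_step:
  assumes B: "self_adjoint B" and bound: "\<And>x. \<bar>x \<bullet> B x\<bar> \<le> T * (x \<bullet> x)" and T: "0 \<le> T"
  shows "2 * T * (B z \<bullet> B z) - B z \<bullet> B (B z) \<le> T\<^sup>2 * (2 * T * (z \<bullet> z) - z \<bullet> B z)"
proof -
  note lin = self_adjointD(1)[OF B] and sym = self_adjointD(2)[OF B]
  note [simp] = linear_add[OF lin] linear_diff[OF lin] linear_cmul[OF lin]
  define u where "u = T *\<^sub>R z - B z"
  have "B z \<bullet> B z \<le> T\<^sup>2 * (z \<bullet> z)"
    using norm_le_of_form_le[OF B, of UNIV T z] bound by simp
  then have "0 \<le> T * (T\<^sup>2 * (z \<bullet> z) - B z \<bullet> B z)" using T by simp
  moreover have "0 \<le> T * (u \<bullet> u) + u \<bullet> B u"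
    using bound[of u] by (simp add: abs_le_iff)
  then have "0 \<le> T * (T\<^sup>2 * (z \<bullet> z) - 2 * T * (z \<bullet> B z) + B z \<bullet> B z)
      + (T\<^sup>2 * (z \<bullet> B z) - 2 * T * (B z \<bullet> B z) + B z \<bullet> B (B z))"
    unfolding u_def using sym[of z "B z"] sym[of z z]
    by (simp add: inner_diff algebra_simps power2_eq_square)
  ultimately show ?thesis by (simp add: algebra_simps power2_eq_square)
qed

lemma contraction_form_iterate:
  assumes B: "self_adjoint B" and bound: "\<And>x. \<bar>x \<bullet> B x\<bar> \<le> T * (x \<bullet> x)" and T: "0 \<le> T"
  shows "2 * T * ((B ^^ k) z \<bullet> (B ^^ k) z) - (B ^^ k) z \<bullet> B ((B ^^ k) z)
    \<le> T ^ (2 * k) * (2 * T * (z \<bullet> z) - z \<bullet> B z)"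
proof (induction k)
  case (Suc k)
  have "2 * T * ((B ^^ Suc k) z \<bullet> (B ^^ Suc k) z) - (B ^^ Suc k) z \<bullet> B ((B ^^ Suc k) z)
    \<le> T\<^sup>2 * (2 * T * ((B ^^ k) z \<bullet> (B ^^ k) z) - (B ^^ k) z \<bullet> B ((B ^^ k) z))"
    using contraction_form_step[OF B bound T] by simp
  also have "\<dots> \<le> T\<^sup>2 * (T ^ (2 * k) * (2 * T * (z \<bullet> z) - z \<bullet> B z))"
    by (intro mult_left_mono Suc) auto
  finally show ?case by (simp add: power2_eq_square mult_ac)
qed simp

text \<open>These identities reduce a comparison with the rank-one form
\<open>\<alpha> * (x \<bullet> x) + (1 - \<alpha>) * (x \<bullet> p)\<^sup>2\<close> to the orthogonal complement of \<open>p\<close>.\<close>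

lemma split_along_unit_fixed_vector:
  assumes A: "self_adjoint A" and p: "A p = p" "p \<bullet> p = 1"
  obtains w where "p \<bullet> w = 0"
    "x \<bullet> x = (x \<bullet> p)\<^sup>2 + w \<bullet> w" "x \<bullet> A x = (x \<bullet> p)\<^sup>2 + w \<bullet> A w"
    "A x \<bullet> A x = (x \<bullet> p)\<^sup>2 + A w \<bullet> A w"
proof -
  note lin = self_adjointD(1)[OF A] and sym = self_adjointD(2)[OF A]
  define w where "w = x - (x \<bullet> p) *\<^sub>R p"
  have x: "x = (x \<bullet> p) *\<^sub>R p + w" by (simp add: w_def)
  have pw: "p \<bullet> w = 0" by (simp add: w_def inner_diff_right p inner_commute)
  have pAw: "p \<bullet> A w = 0" using sym[of p w] p pw by simp
  have Ax: "A x = (x \<bullet> p) *\<^sub>R p + A w"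
    by (subst x) (simp add: linear_add[OF lin] linear_cmul[OF lin] p)
  have "x \<bullet> x = (x \<bullet> p)\<^sup>2 + w \<bullet> w"
    by (subst (1 2) x) (simp add: inner_add p pw inner_commute[of w p] power2_eq_square)
  moreover have "x \<bullet> A x = (x \<bullet> p)\<^sup>2 + w \<bullet> A w"
    unfolding Ax by (subst (1) x) (simp add: inner_add p pw pAw inner_commute[of w p] power2_eq_square)
  moreover have "A x \<bullet> A x = (x \<bullet> p)\<^sup>2 + A w \<bullet> A w"
    unfolding Ax by (simp add: inner_add p pAw inner_commute[of "A w" p] power2_eq_square)
  ultimately show thesis using that pw by blast
qed

context
  fixes A :: "'a::euclidean_space \<Rightarrow> 'a" and p :: 'a
  assumes A: "self_adjoint A" and p: "A p = p" "p \<bullet> p = 1"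
begin

lemma orthogonal_complement_invariant:
  "subspace {w. p \<bullet> w = 0}" "w \<in> {w. p \<bullet> w = 0} \<Longrightarrow> A w \<in> {w. p \<bullet> w = 0}"
  using self_adjointD(2)[OF A, of p w] p by (auto intro!: subspaceI simp: inner_add)

lemma form_le_rank_one:
  assumes gap: "\<And>w. p \<bullet> w = 0 \<Longrightarrow> w \<bullet> A w \<le> \<alpha> * (w \<bullet> w)"
  shows "x \<bullet> A x \<le> \<alpha> * (x \<bullet> x) + (1 - \<alpha>) * (x \<bullet> p)\<^sup>2"
proof -
  obtain w where w: "p \<bullet> w = 0"
    "x \<bullet> x = (x \<bullet> p)\<^sup>2 + w \<bullet> w" "x \<bullet> A x = (x \<bullet> p)\<^sup>2 + w \<bullet> A w"
    using split_along_unit_fixed_vector[OF A p] by metis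
  from gap[OF w(1)] show ?thesis unfolding w(2,3) by (simp add: algebra_simps)
qed

lemma square_form_le_rank_one:
  assumes gap: "\<And>w. p \<bullet> w = 0 \<Longrightarrow> \<bar>w \<bullet> A w\<bar> \<le> \<beta> * (w \<bullet> w)"
  shows "A x \<bullet> A x \<le> \<beta>\<^sup>2 * (x \<bullet> x) + (1 - \<beta>\<^sup>2) * (x \<bullet> p)\<^sup>2"
proof -
  obtain w where w: "p \<bullet> w = 0"
    "x \<bullet> x = (x \<bullet> p)\<^sup>2 + w \<bullet> w" "A x \<bullet> A x = (x \<bullet> p)\<^sup>2 + A w \<bullet> A w"
    using split_along_unit_fixed_vector[OF A p] by metis
  have "A w \<bullet> A w \<le> \<beta>\<^sup>2 * (w \<bullet> w)"
    using gap w(1) orthogonal_complement_invariant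
    by (intro norm_le_of_form_le[OF A, where W = "{w. p \<bullet> w = 0}"]) auto
  then show ?thesis unfolding w(2,3) by (simp add: algebra_simps)
qed

text \<open>On the complement of \<open>p\<close> the spectrum of \<open>A\<close> lies in \<open>[- 1, \<alpha>]\<close>, and there
\<open>2 \<alpha> - \<lambda> - \<lambda>^2 = (\<alpha> - \<lambda>) (1 + \<lambda>) + \<alpha> (1 - \<lambda>)\<close> is nonnegative. Eigenvalues near
\<open>- 1\<close> contribute to the square of \<open>A\<close> as much as the fixed vector does; adding \<open>A\<close> cancels them.\<close>

lemma square_plus_form_le_rank_one:
  assumes gap: "\<And>w. p \<bullet> w = 0 \<Longrightarrow> w \<bullet> A w \<le> \<alpha> * (w \<bullet> w)"
    and contraction: "\<And>w. \<bar>w \<bullet> A w\<bar> \<le> w \<bullet> w" and \<alpha>: "0 \<le> \<alpha>" "\<alpha> \<le> 1"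
  shows "A x \<bullet> A x + x \<bullet> A x \<le> 2 * (\<alpha> * (x \<bullet> x) + (1 - \<alpha>) * (x \<bullet> p)\<^sup>2)"
proof -
  obtain w where w: "p \<bullet> w = 0"
    "x \<bullet> x = (x \<bullet> p)\<^sup>2 + w \<bullet> w" "x \<bullet> A x = (x \<bullet> p)\<^sup>2 + w \<bullet> A w"
    "A x \<bullet> A x = (x \<bullet> p)\<^sup>2 + A w \<bullet> A w"
    using split_along_unit_fixed_vector[OF A p] by metis
  have "A w \<bullet> A w \<le> (\<alpha> - 1) * (w \<bullet> A w) + \<alpha> * 1 * (w \<bullet> w)"
  proof (rule square_form_le[OF A, where W = "{w. p \<bullet> w = 0}"])
    show "- (1 * (x \<bullet> x)) \<le> x \<bullet> A x" for x
      using contraction[of x] by (simp add: abs_le_iff)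
  qed (use gap w(1) \<alpha> orthogonal_complement_invariant in auto)
  moreover have "\<alpha> * (w \<bullet> A w) \<le> \<alpha> * (w \<bullet> w)"
    using contraction[of w] \<alpha> by (intro mult_left_mono) (auto simp: abs_le_iff)
  ultimately show ?thesis unfolding w(2-4) by (simp add: algebra_simps)
qed

end

section \<open>Reversible chains and their spectrum\<close>

text \<open>Irreducibility is expressed by \<open>harmonic_const\<close>, the form in which it makes the eigenvalue 1 simple.\<close>

locale reversible_chain =
  fixes P :: "real^'v^'v::finite" and s :: "real^'v"
  assumes s_pos: "0 < s $ i"
    and s_sum: "(\<Sum>i\<in>UNIV. s $ i) = 1"
    and P_nonneg: "0 \<le> P $ i $ j"
    and P_col: "(\<Sum>i\<in>UNIV. P $ i $ j) = 1"
    and detailed_balance: "s $ j * P $ i $ j = s $ i * P $ j $ i"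
    and harmonic_const: "(\<And>i. (\<Sum>j\<in>UNIV. P $ j $ i * h j) = h i) \<Longrightarrow> h i = h j"
begin

definition sqrt_s :: "real^'v" where
  "sqrt_s = (\<chi> i. sqrt (s $ i))"

text \<open>The conjugate of \<open>P\<close> by the diagonal matrix of \<open>sqrt s\<close>, symmetric by detailed balance.\<close>

definition S :: "real^'v \<Rightarrow> real^'v" where
  "S x = (\<chi> i. \<Sum>j\<in>UNIV. P $ i $ j * sqrt (s $ j) / sqrt (s $ i) * x $ j)"

lemma sqrt_s_nz [simp]: "sqrt (s $ i) \<noteq> 0" "s $ i \<noteq> 0" "0 \<le> s $ i"
  using s_pos[of i] by auto

lemma sqrt_s_sq [simp]: "sqrt (s $ i) * sqrt (s $ i) = s $ i"
  by simp

lemma S_nth_eq_flow: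
  "S x $ i = (\<Sum>j\<in>UNIV. s $ j * P $ i $ j * (x $ j / sqrt (s $ j))) / sqrt (s $ i)"
proof -
  have "P $ i $ j * sqrt (s $ j) / sqrt (s $ i) * x $ j
      = s $ j * P $ i $ j * (x $ j / sqrt (s $ j)) / sqrt (s $ i)" for j
    using sqrt_s_sq[of j] sqrt_s_nz[of j] by (simp add: field_simps del: sqrt_s_sq real_sqrt_mult_self)
  then show ?thesis by (simp add: S_def sum_divide_distrib)
qed

text \<open>In terms of \<open>x / sqrt s\<close> the form of \<open>S\<close> has as coefficients the stationary flow
\<open>s $ j * P $ i $ j\<close>, which is symmetric and has both marginals equal to \<open>s\<close>.\<close>

lemma inner_S_eq_flow:
  "x \<bullet> S y = (\<Sum>i\<in>UNIV. \<Sum>j\<in>UNIV. s $ j * P $ i $ j * ((x $ i / sqrt (s $ i)) * (y $ j / sqrt (s $ j))))"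
  by (simp add: inner_vec_def S_nth_eq_flow sum_distrib_left sum_divide_distrib mult_ac)

lemma flow_row: "(\<Sum>j\<in>UNIV. s $ j * P $ i $ j) = s $ i"
proof -
  have "(\<Sum>j\<in>UNIV. s $ j * P $ i $ j) = (\<Sum>j\<in>UNIV. s $ i * P $ j $ i)"
    by (rule sum.cong[OF refl detailed_balance])
  then show ?thesis by (simp add: P_col flip: sum_distrib_left)
qed

lemma self_adjoint_S: "self_adjoint S"
proof -
  have "linear S"
    by (rule linearI)
      (simp_all add: S_def vec_eq_iff distrib_left sum.distrib sum_distrib_left mult_ac add_divide_distrib)
  moreover have "S x \<bullet> y = x \<bullet> S y" for x y
    unfolding inner_commute[of "S x"] inner_S_eq_flow
    by (subst sum.swap) (simp add: detailed_balance mult_ac)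
  ultimately show ?thesis by (simp add: self_adjoint_def)
qed

lemma S_sqrt_s: "S sqrt_s = sqrt_s"
  by (simp add: vec_eq_iff S_nth_eq_flow flow_row) (simp add: sqrt_s_def flow_row real_div_sqrt less_imp_le s_pos)

lemma sqrt_s_unit: "sqrt_s \<bullet> sqrt_s = 1"
  by (simp add: inner_vec_def sqrt_s_def s_sum)

lemma S_contraction: "\<bar>x \<bullet> S x\<bar> \<le> x \<bullet> x"
proof -
  define g where "g i = x $ i / sqrt (s $ i)" for i
  have g2: "s $ i * (g i)\<^sup>2 = x $ i * x $ i" for i
    by (simp add: g_def power_divide power2_eq_square[of "x $ i"])
  have "\<bar>x \<bullet> S x\<bar> \<le> (\<Sum>i\<in>UNIV. \<Sum>j\<in>UNIV. \<bar>s $ j * P $ i $ j * (g i * g j)\<bar>)"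
    unfolding inner_S_eq_flow g_def[symmetric]
    by (rule order_trans[OF sum_abs]) (intro sum_mono sum_abs)
  also have "\<dots> \<le> (\<Sum>i\<in>UNIV. \<Sum>j\<in>UNIV. s $ j * P $ i $ j * ((g i)\<^sup>2 / 2 + (g j)\<^sup>2 / 2))"
  proof (intro sum_mono)
    fix i j
    have "\<bar>g i * g j\<bar> \<le> (g i)\<^sup>2 / 2 + (g j)\<^sup>2 / 2"
      using sum_squares_bound[of "\<bar>g i\<bar>" "\<bar>g j\<bar>"] by (simp add: abs_mult)
    then show "\<bar>s $ j * P $ i $ j * (g i * g j)\<bar> \<le> s $ j * P $ i $ j * ((g i)\<^sup>2 / 2 + (g j)\<^sup>2 / 2)"
      using P_nonneg[of i j] s_pos[of j] by (simp add: abs_mult mult_left_mono)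
  qed
  also have "\<dots> = (\<Sum>i\<in>UNIV. (\<Sum>j\<in>UNIV. s $ j * P $ i $ j) * (g i)\<^sup>2 / 2)
      + (\<Sum>j\<in>UNIV. (\<Sum>i\<in>UNIV. s $ j * P $ i $ j) * (g j)\<^sup>2 / 2)"
  proof -
    have "(\<Sum>i\<in>UNIV. \<Sum>j\<in>UNIV. s $ j * P $ i $ j * ((g j)\<^sup>2 / 2))
        = (\<Sum>j\<in>UNIV. \<Sum>i\<in>UNIV. s $ j * P $ i $ j * ((g j)\<^sup>2 / 2))"
      by (rule sum.swap)
    then show ?thesis
      by (simp only: distrib_left sum.distrib sum_distrib_right times_divide_eq_right sum_divide_distrib)
  qed
  also have "\<dots> = (\<Sum>i\<in>UNIV. s $ i * (g i)\<^sup>2)"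
    unfolding flow_row by (simp add: P_col flip: sum_distrib_left sum_divide_distrib)
  also have "\<dots> = x \<bullet> x"
    by (simp add: g2 inner_vec_def)
  finally show ?thesis .
qed

text \<open>The Perron-Frobenius principle for the nonnegative matrix of \<open>S\<close>: lower bounds on the form follow
from upper bounds.\<close>

lemma inner_S_abs_le:
  "\<bar>x \<bullet> S x\<bar> \<le> (\<chi> i. \<bar>x $ i\<bar>) \<bullet> S (\<chi> i. \<bar>x $ i\<bar>)"
proof -
  have "\<bar>x \<bullet> S x\<bar> \<le> (\<Sum>i\<in>UNIV. \<Sum>j\<in>UNIV.
      \<bar>s $ j * P $ i $ j * ((x $ i / sqrt (s $ i)) * (x $ j / sqrt (s $ j)))\<bar>)"
    unfolding inner_S_eq_flow by (rule order_trans[OF sum_abs]) (intro sum_mono sum_abs)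
  also have "\<dots> = (\<chi> i. \<bar>x $ i\<bar>) \<bullet> S (\<chi> i. \<bar>x $ i\<bar>)"
    unfolding inner_S_eq_flow using s_pos P_nonneg by (simp add: abs_mult abs_divide less_imp_le)
  finally show ?thesis .
qed

lemma eigenvector_transfer:
  "P *v (\<chi> i. sqrt (s $ i) * x $ i) = (\<chi> i. sqrt (s $ i) * S x $ i)"
  by (simp add: vec_eq_iff matrix_vector_mult_def S_def sum_distrib_left mult_ac)

lemma eigenvector_of_S:
  assumes "l \<in> eigenvalues P"
  obtains w where "w \<noteq> 0" "S w = l *\<^sub>R w"
proof -
  obtain v where v: "v \<noteq> 0" "P *v v = l *\<^sub>R v" using assms by (auto simp: eigenvalues_def)
  define w where "w = (\<chi> i. v $ i / sqrt (s $ i))"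
  have vw: "v = (\<chi> i. sqrt (s $ i) * w $ i)" by (simp add: w_def vec_eq_iff)
  show thesis
  proof
    show "w \<noteq> 0" using v(1) by (subst (asm) vw) (auto simp: vec_eq_iff)
    show "S w = l *\<^sub>R w"
      using v(2) eigenvector_transfer[of w] unfolding vw[symmetric]
      by (simp add: vec_eq_iff w_def field_simps)
  qed
qed

text \<open>An eigenvector for the eigenvalue 1 yields a harmonic function \<open>w / sqrt s\<close>; this is constant, which
makes \<open>w\<close> a multiple of \<open>sqrt_s\<close>.\<close>

lemma eigenvalue_of_S_nontrivial:
  assumes w: "sqrt_s \<bullet> w = 0" "w \<noteq> 0" and ev: "S w = l *\<^sub>R w"
  shows "l \<in> eigenvalues P - {1}"
proof -
  define v where "v = (\<chi> i. sqrt (s $ i) * w $ i)"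
  have "v \<noteq> 0" using w(2) by (auto simp: v_def vec_eq_iff)
  moreover have "P *v v = l *\<^sub>R v"
    unfolding v_def eigenvector_transfer ev by (simp add: vec_eq_iff)
  ultimately have "l \<in> eigenvalues P" by (auto simp: eigenvalues_def)
  moreover have "l \<noteq> 1"
  proof
    assume "l = 1"
    define h where "h i = w $ i / sqrt (s $ i)" for i
    have "(\<Sum>j\<in>UNIV. P $ j $ i * h j) = h i" for i
    proof -
      have "s $ i * (\<Sum>j\<in>UNIV. P $ j $ i * h j) = (\<Sum>j\<in>UNIV. s $ j * P $ i $ j * h j)"
        by (simp add: sum_distrib_left detailed_balance mult_ac)
      also have "\<dots> = sqrt (s $ i) * S w $ i"
        by (simp add: S_nth_eq_flow h_def)
      also have "\<dots> = s $ i * h i"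
        using sqrt_s_sq[of i] by (simp add: ev \<open>l = 1\<close> h_def field_simps del: sqrt_s_sq real_sqrt_mult_self)
      finally show ?thesis by simp
    qed
    then have h: "h i = h j" for i j by (rule harmonic_const)
    have wh: "w = h undefined *\<^sub>R sqrt_s"
      using h[of _ undefined] by (simp add: vec_eq_iff sqrt_s_def h_def field_simps)
    then show False using w by (metis inner_scaleR_right mult.right_neutral scale_zero_left sqrt_s_unit)
  qed
  ultimately show ?thesis by simp
qed

text \<open>Finiteness is what gives meaning to the maxima in the definitions of the spectral quantities. It holds
because eigenvectors of \<open>S\<close> for different eigenvalues are orthogonal.\<close>

lemma finite_eigenvalues: "finite (eigenvalues P)"
proof -
  obtain w where w: "\<And>l. l \<in> eigenvalues P \<Longrightarrow> w l \<noteq> 0 \<and> S (w l) = l *\<^sub>R w l"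
  proof -
    have "\<forall>l\<in>eigenvalues P. \<exists>w. w \<noteq> 0 \<and> S w = l *\<^sub>R w"
      using eigenvector_of_S by blast
    then show ?thesis using that by (auto simp: bchoice_iff)
  qed
  have orth: "w l \<bullet> w m = 0" if "l \<in> eigenvalues P" "m \<in> eigenvalues P" "l \<noteq> m" for l m
    using self_adjointD(2)[OF self_adjoint_S, of "w l" "w m"] w that by simp
  have "inj_on w (eigenvalues P)"
    using orth w by (metis inj_onI inner_eq_zero_iff)
  moreover have "finite (w ` eigenvalues P)"
    by (rule pairwise_orthogonal_imp_finite) (use orth in \<open>auto simp: pairwise_def orthogonal_def\<close>)
  ultimately show ?thesis by (metis finite_imageD)
qed

lemma eigenvalue_abs_le_one:
  assumes "l \<in> eigenvalues P"
  shows "\<bar>l\<bar> \<le> 1"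
proof -
  obtain w where w: "w \<noteq> 0" "S w = l *\<^sub>R w" using eigenvector_of_S[OF assms] .
  have "0 < w \<bullet> w" using w(1) by simp
  moreover have "\<bar>l\<bar> * (w \<bullet> w) \<le> 1 * (w \<bullet> w)"
    using S_contraction[of w] w(2) by (simp add: abs_mult)
  ultimately show ?thesis by (metis mult_le_cancel_right_pos)
qed

lemma spec_alpha_bounds:
  "0 \<le> spec_alpha P" "spec_alpha P < 1" "l \<in> eigenvalues P - {1} \<Longrightarrow> l \<le> spec_alpha P"
proof -
  have fin: "finite (insert 0 (eigenvalues P - {1}))" using finite_eigenvalues by simp
  show "0 \<le> spec_alpha P" "l \<in> eigenvalues P - {1} \<Longrightarrow> l \<le> spec_alpha P"
    unfolding spec_alpha_def using fin by (auto intro!: Max_ge simp del: Max_insert)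
  have "spec_alpha P \<in> insert 0 (eigenvalues P - {1})"
    unfolding spec_alpha_def by (rule Max_in[OF fin]) simp
  then show "spec_alpha P < 1" using eigenvalue_abs_le_one by fastforce
qed

lemma spec_beta_bounds:
  "l \<in> eigenvalues P - {1} \<Longrightarrow> \<bar>l\<bar> \<le> spec_beta P"
  "eigenvalues P - {1} \<noteq> {} \<Longrightarrow> 0 \<le> spec_beta P \<and> spec_beta P \<le> 1"
proof -
  have fin: "finite (abs ` (eigenvalues P - {1}))" using finite_eigenvalues by simp
  show "\<bar>l\<bar> \<le> spec_beta P" if "l \<in> eigenvalues P - {1}"
    unfolding spec_beta_def using fin that by (intro Max_ge) auto
  assume "eigenvalues P - {1} \<noteq> {}"
  then have "spec_beta P \<in> abs ` (eigenvalues P - {1})"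
    unfolding spec_beta_def by (intro Max_in[OF fin]) simp
  then show "0 \<le> spec_beta P \<and> spec_beta P \<le> 1" using eigenvalue_abs_le_one by auto
qed

lemma top_eigenvalue_off_constants:
  assumes A: "self_adjoint A" "A sqrt_s = c *\<^sub>R sqrt_s" and "sqrt_s \<bullet> x = 0" "x \<noteq> 0"
  obtains v \<mu> where "sqrt_s \<bullet> v = 0" "v \<noteq> 0" "A v = \<mu> *\<^sub>R v"
    "\<And>w. sqrt_s \<bullet> w = 0 \<Longrightarrow> w \<bullet> A w \<le> \<mu> * (w \<bullet> w)"
proof -
  have inv: "A w \<in> {w. sqrt_s \<bullet> w = 0}" if "w \<in> {w. sqrt_s \<bullet> w = 0}" for w
    using that self_adjointD(2)[OF A(1), of sqrt_s w] A(2) by simp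
  have "subspace {w. sqrt_s \<bullet> w = 0}" "{w. sqrt_s \<bullet> w = 0} \<noteq> {0}"
    using assms(3,4) by (auto intro!: subspaceI simp: inner_add)
  from exists_top_eigenvector[OF A(1) this(1) inv this(2)] that show thesis by auto
qed

lemma exists_nontrivial_eigenvalue:
  assumes "sqrt_s \<bullet> x = 0" "x \<noteq> 0"
  shows "eigenvalues P - {1} \<noteq> {}"
  using top_eigenvalue_off_constants[OF self_adjoint_S, of 1 x] S_sqrt_s assms eigenvalue_of_S_nontrivial
  by (metis empty_iff scaleR_one)

lemma S_le_spec_alpha:
  assumes "sqrt_s \<bullet> w = 0"
  shows "w \<bullet> S w \<le> spec_alpha P * (w \<bullet> w)"
proof (cases "w = 0")
  case False
  obtain v \<mu> where v: "sqrt_s \<bullet> v = 0" "v \<noteq> 0" "S v = \<mu> *\<^sub>R v"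
      and le: "\<And>w. sqrt_s \<bullet> w = 0 \<Longrightarrow> w \<bullet> S w \<le> \<mu> * (w \<bullet> w)"
    using top_eigenvalue_off_constants[OF self_adjoint_S, of 1 w] S_sqrt_s assms False by auto
  have "\<mu> \<le> spec_alpha P"
    using eigenvalue_of_S_nontrivial[OF v] by (rule spec_alpha_bounds)
  then show ?thesis
    by (intro order_trans[OF le[OF assms]] mult_right_mono) auto
qed simp

lemma abs_S_le_spec_beta:
  assumes "sqrt_s \<bullet> w = 0"
  shows "\<bar>w \<bullet> S w\<bar> \<le> spec_beta P * (w \<bullet> w)"
proof (cases "w = 0")
  case False
  have neg: "self_adjoint (\<lambda>x. - S x)"
    using self_adjointD[OF self_adjoint_S] by (auto simp: self_adjoint_def intro: linear_compose_neg)
  obtain v \<mu> where v: "sqrt_s \<bullet> v = 0" "v \<noteq> 0" "S v = \<mu> *\<^sub>R v"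
      and le: "\<And>w. sqrt_s \<bullet> w = 0 \<Longrightarrow> w \<bullet> S w \<le> \<mu> * (w \<bullet> w)"
    using top_eigenvalue_off_constants[OF self_adjoint_S, of 1 w] S_sqrt_s assms False by auto
  obtain v' \<nu> where v': "sqrt_s \<bullet> v' = 0" "v' \<noteq> 0" "- S v' = \<nu> *\<^sub>R v'"
      and ge: "\<And>w. sqrt_s \<bullet> w = 0 \<Longrightarrow> w \<bullet> - S w \<le> \<nu> * (w \<bullet> w)"
    using top_eigenvalue_off_constants[OF neg, of "- 1" w] S_sqrt_s assms False by auto
  have "S v' = (- \<nu>) *\<^sub>R v'" using v'(3) by (simp add: minus_equation_iff)
  from spec_beta_bounds(1)[OF eigenvalue_of_S_nontrivial[OF v]]
    spec_beta_bounds(1)[OF eigenvalue_of_S_nontrivial[OF v'(1,2) this]]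
  have "\<mu> \<le> spec_beta P" "\<nu> \<le> spec_beta P" by linarith+
  then have "\<mu> * (w \<bullet> w) \<le> spec_beta P * (w \<bullet> w)" "\<nu> * (w \<bullet> w) \<le> spec_beta P * (w \<bullet> w)"
    by (auto intro: mult_right_mono)
  then show ?thesis using le[OF assms] ge[OF assms] by (simp add: abs_le_iff)
qed simp

end

section \<open>Exponentially tilted operators\<close>

definition tilt :: "('v::finite \<Rightarrow> real) \<Rightarrow> real \<Rightarrow> real^'v \<Rightarrow> real^'v" where
  "tilt f a x = (\<chi> i. exp (a * f i) * x $ i)"

lemma tilt_tilt: "tilt f a (tilt f b x) = tilt f (a + b) x"
  by (simp add: tilt_def vec_eq_iff distrib_right exp_add)

lemma self_adjoint_tilt: "self_adjoint (tilt f a)"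
  unfolding self_adjoint_def tilt_def
  by (auto intro!: linearI simp: vec_eq_iff algebra_simps inner_vec_def)

lemma self_adjoint_sandwich:
  assumes A: "self_adjoint A" and E: "self_adjoint E"
  shows "self_adjoint (\<lambda>x. E (A (E x)))"
  using linear_compose[OF linear_compose[OF self_adjointD(1)[OF E] self_adjointD(1)[OF A]] self_adjointD(1)[OF E]]
  by (simp add: self_adjoint_def o_def self_adjointD(2)[OF A] self_adjointD(2)[OF E])

context reversible_chain
begin

context
  fixes f :: "'v \<Rightarrow> real" and V :: real
  assumes f_le: "\<And>i. f i \<le> 1" and f_mean: "(\<Sum>i\<in>UNIV. f i * s $ i) = 0"
    and V: "V = (\<Sum>i\<in>UNIV. (f i)\<^sup>2 * s $ i)"
begin

lemma rank_one_tilt_le: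
  assumes "0 \<le> \<alpha>" "\<alpha> < 1" "0 < r" "r < (1 - \<alpha>) / (1 + \<alpha>)"
  shows "\<alpha> * (x \<bullet> x) + (1 - \<alpha>) * (x \<bullet> sqrt_s)\<^sup>2 \<le> bernstein_rate \<alpha> V r * (x \<bullet> tilt f (- r) x)"
  using rank_one_bernstein[of "($) s" f V \<alpha> r "($) x"] assms f_le f_mean V s_sum s_pos
  by (simp add: inner_vec_def sqrt_s_def tilt_def power2_eq_square mult_ac)

text \<open>The right-hand side is the stationary mean of \<open>exp (r * (f (X 0) + f (X 1)))\<close>, whose exponent has mean 0.\<close>

lemma one_le_mgf_two_steps: "1 \<le> tilt f r sqrt_s \<bullet> S (tilt f r sqrt_s)"
proof -
  have "(\<Sum>i\<in>UNIV. \<Sum>j\<in>UNIV. s $ j * P $ i $ j * (1 + r * f i + r * f j))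
      = (\<Sum>i\<in>UNIV. (\<Sum>j\<in>UNIV. s $ j * P $ i $ j) * (1 + r * f i))
        + (\<Sum>i\<in>UNIV. \<Sum>j\<in>UNIV. s $ j * P $ i $ j * (r * f j))"
    by (simp add: distrib_left sum.distrib sum_distrib_right)
  also have "(\<Sum>i\<in>UNIV. \<Sum>j\<in>UNIV. s $ j * P $ i $ j * (r * f j))
      = (\<Sum>j\<in>UNIV. (\<Sum>i\<in>UNIV. s $ j * P $ i $ j) * (r * f j))"
    by (subst sum.swap) (simp add: sum_distrib_right)
  also have "\<dots> = r * (\<Sum>j\<in>UNIV. f j * s $ j)"
    by (simp add: P_col sum_distrib_left mult_ac flip: sum_distrib_left[of "s $ _"])
  also have "(\<Sum>i\<in>UNIV. (\<Sum>j\<in>UNIV. s $ j * P $ i $ j) * (1 + r * f i))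
      = 1 + r * (\<Sum>i\<in>UNIV. f i * s $ i)"
    by (simp add: flow_row distrib_left sum.distrib s_sum sum_distrib_left mult_ac)
  finally have "1 = (\<Sum>i\<in>UNIV. \<Sum>j\<in>UNIV. s $ j * P $ i $ j * (1 + r * f i + r * f j))"
    by (simp add: f_mean)
  also have "\<dots> \<le> (\<Sum>i\<in>UNIV. \<Sum>j\<in>UNIV. s $ j * P $ i $ j * (exp (r * f i) * exp (r * f j)))"
  proof (intro sum_mono mult_left_mono)
    show "1 + r * f i + r * f j \<le> exp (r * f i) * exp (r * f j)" for i j
      using exp_ge_add_one_self[of "r * f i + r * f j"] by (simp add: exp_add add.assoc)
  qed (use s_pos P_nonneg in \<open>auto simp: less_imp_le\<close>)
  also have "\<dots> = tilt f r sqrt_s \<bullet> S (tilt f r sqrt_s)"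
    unfolding inner_S_eq_flow by (simp add: tilt_def sqrt_s_def)
  finally show ?thesis .
qed

text \<open>The rank-one estimate at \<open>x = tilt f r sqrt_s\<close>: there \<open>(x \<bullet> sqrt_s)\<^sup>2 \<le> x \<bullet> x\<close>, so its left-hand side
is at least the square of the mean to be bounded, and its right-hand side is the rate times that mean.\<close>

lemma mgf_one_step_le:
  assumes \<alpha>: "0 \<le> \<alpha>" "\<alpha> < 1" and r: "0 < r" "r < (1 - \<alpha>) / (1 + \<alpha>)"
  shows "sqrt_s \<bullet> tilt f r sqrt_s \<le> bernstein_rate \<alpha> V r"
proof -
  define x where "x = tilt f r sqrt_s"
  define m where "m = sqrt_s \<bullet> x"
  have m: "0 < m"
    unfolding m_def x_def inner_vec_def tilt_def sqrt_s_def
    by (intro sum_pos) (auto simp: s_pos)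
  have "m\<^sup>2 \<le> x \<bullet> x"
    using Cauchy_Schwarz_ineq[of sqrt_s x] sqrt_s_unit by (simp add: m_def)
  then have "m\<^sup>2 \<le> \<alpha> * (x \<bullet> x) + (1 - \<alpha>) * m\<^sup>2"
    using mult_left_mono[of "m\<^sup>2" "x \<bullet> x" \<alpha>] \<alpha> by (simp add: algebra_simps)
  also have "\<dots> \<le> bernstein_rate \<alpha> V r * (x \<bullet> tilt f (- r) x)"
    using rank_one_tilt_le[OF \<alpha> r, of x] by (simp add: m_def inner_commute)
  also have "x \<bullet> tilt f (- r) x = m"
    by (simp add: x_def m_def tilt_tilt inner_commute) (simp add: tilt_def)
  finally show ?thesis using m by (simp add: power2_eq_square m_def x_def)
qed

lemma norm_tilted_step_le:
  assumes \<beta>: "0 \<le> spec_beta P" "spec_beta P < 1"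
    and r: "0 < r" "2 * r < (1 - (spec_beta P)\<^sup>2) / (1 + (spec_beta P)\<^sup>2)"
  shows "S (tilt f r y) \<bullet> S (tilt f r y) \<le> bernstein_rate ((spec_beta P)\<^sup>2) V (2 * r) * (y \<bullet> y)"
proof -
  define x where "x = tilt f r y"
  have \<beta>2: "0 \<le> (spec_beta P)\<^sup>2" "(spec_beta P)\<^sup>2 < 1"
    using \<beta> by (auto simp: power2_less_1_iff abs_square_less_1)
  have "S x \<bullet> S x \<le> (spec_beta P)\<^sup>2 * (x \<bullet> x) + (1 - (spec_beta P)\<^sup>2) * (x \<bullet> sqrt_s)\<^sup>2"
    by (rule square_form_le_rank_one[OF self_adjoint_S S_sqrt_s sqrt_s_unit abs_S_le_spec_beta])
  also have "\<dots> \<le> bernstein_rate ((spec_beta P)\<^sup>2) V (2 * r) * (x \<bullet> tilt f (- (2 * r)) x)"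
    using r by (intro rank_one_tilt_le \<beta>2) auto
  also have "x \<bullet> tilt f (- (2 * r)) x = y \<bullet> y"
    unfolding x_def self_adjointD(2)[OF self_adjoint_tilt] tilt_tilt by (simp add: tilt_def)
  finally show ?thesis by (simp add: x_def)
qed

lemma norm_tilted_power_le_spec_beta:
  assumes \<beta>: "0 \<le> spec_beta P" "spec_beta P < 1"
    and r: "0 < r" "2 * r < (1 - (spec_beta P)\<^sup>2) / (1 + (spec_beta P)\<^sup>2)"
  shows "(norm (((\<lambda>x. S (tilt f r x)) ^^ n) sqrt_s))\<^sup>2 \<le> bernstein_rate ((spec_beta P)\<^sup>2) V (2 * r) ^ n"
proof (induction n)
  case 0
  then show ?case by (simp add: power2_norm_eq_inner sqrt_s_unit)
next
  case (Suc n)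
  show ?case
    using order_trans[OF norm_tilted_step_le[OF \<beta> r] mult_left_mono[OF Suc.IH[unfolded power2_norm_eq_inner]]]
    by (simp add: power2_norm_eq_inner bernstein_rate_def)
qed

text \<open>A single step can expand by more than the rate when \<open>S\<close> has eigenvalues near \<open>- 1\<close>,
so the power is written as \<open>S (E z)\<close> with \<open>z = (B ^^ k) (E sqrt_s)\<close>, where \<open>E\<close> tilts by half of \<open>r\<close> and
\<open>B\<close> is the symmetric operator \<open>E S E\<close>. The square of the outer \<open>S\<close> is bounded by
\<open>square_plus_form_le_rank_one\<close>, which leaves the form \<open>2 T - B\<close> at \<open>z\<close>; this form is traced back to \<open>k = 0\<close>.\<close>

lemma norm_tilted_power_le_spec_alpha:
  assumes r: "0 < r" "r < (1 - spec_alpha P) / (1 + spec_alpha P)"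
  shows "norm (((\<lambda>x. S (tilt f r x)) ^^ Suc k) sqrt_s) \<le> bernstein_rate (spec_alpha P) V r ^ (k + 2)"
proof -
  define \<alpha> T where "\<alpha> = spec_alpha P" and "T = bernstein_rate \<alpha> V r"
  define E where "E = tilt f (r / 2)"
  define B where "B x = E (S (E x))" for x
  have \<alpha>: "0 \<le> \<alpha>" "\<alpha> < 1" unfolding \<alpha>_def by (rule spec_alpha_bounds)+
  note r = r[folded \<alpha>_def]
  have T0: "0 < T" by (simp add: T_def bernstein_rate_def)
  have T: "1 \<le> T"
    unfolding T_def bernstein_rate_def one_le_exp_iff V using r
    by (intro mult_nonneg_nonneg sum_nonneg divide_nonneg_nonneg) auto
  have saE: "self_adjoint E" unfolding E_def by (rule self_adjoint_tilt)
  have EE: "E (E x) = tilt f r x" for x by (simp add: E_def tilt_tilt)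
  have R: "\<alpha> * (E z \<bullet> E z) + (1 - \<alpha>) * (E z \<bullet> sqrt_s)\<^sup>2 \<le> T * (z \<bullet> z)" for z
  proof -
    have "E z \<bullet> tilt f (- r) (E z) = z \<bullet> z"
      unfolding E_def self_adjointD(2)[OF self_adjoint_tilt] tilt_tilt by (simp add: tilt_def)
    then show ?thesis using rank_one_tilt_le[OF \<alpha> r, of "E z"] by (simp add: T_def)
  qed
  have saB: "self_adjoint B" unfolding B_def by (rule self_adjoint_sandwich[OF self_adjoint_S saE])
  have zBz: "z \<bullet> B z = E z \<bullet> S (E z)" for z
    by (simp add: B_def self_adjointD(2)[OF saE])
  have bound: "\<bar>z \<bullet> B z\<bar> \<le> T * (z \<bullet> z)" for z
  proof -
    \<comment> \<open>\<open>B\<close> has nonnegative entries, so absolute values turn the upper bound into a two-sided one\<close>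
    define z' where "z' = (\<chi> i. \<bar>z $ i\<bar>)"
    have "E z' = (\<chi> i. \<bar>E z $ i\<bar>)" by (simp add: z'_def E_def tilt_def abs_mult)
    then have "\<bar>z \<bullet> B z\<bar> \<le> E z' \<bullet> S (E z')" unfolding zBz using inner_S_abs_le by metis
    also have "\<dots> \<le> \<alpha> * (E z' \<bullet> E z') + (1 - \<alpha>) * (E z' \<bullet> sqrt_s)\<^sup>2"
      unfolding \<alpha>_def by (rule form_le_rank_one[OF self_adjoint_S S_sqrt_s sqrt_s_unit S_le_spec_alpha])
    also have "\<dots> \<le> T * (z' \<bullet> z')" by (rule R)
    also have "z' \<bullet> z' = z \<bullet> z" by (simp add: z'_def inner_vec_def)
    finally show ?thesis .
  qed
  define z0 z where "z0 = E sqrt_s" and "z = (B ^^ k) z0"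
  have comm: "E (((\<lambda>x. S (tilt f r x)) ^^ k) sqrt_s) = z"
    unfolding z_def z0_def by (induction k) (simp_all add: B_def[abs_def] EE[symmetric])
  have "((\<lambda>x. S (tilt f r x)) ^^ Suc k) sqrt_s = S (E z)"
    by (simp add: comm[symmetric] EE)
  moreover have "S (E z) \<bullet> S (E z) \<le> (T ^ (k + 2))\<^sup>2"
  proof -
    have "S (E z) \<bullet> S (E z) + E z \<bullet> S (E z) \<le> 2 * (\<alpha> * (E z \<bullet> E z) + (1 - \<alpha>) * (E z \<bullet> sqrt_s)\<^sup>2)"
      using \<alpha> S_contraction unfolding \<alpha>_def
      by (intro square_plus_form_le_rank_one[OF self_adjoint_S S_sqrt_s sqrt_s_unit S_le_spec_alpha]) auto
    then have "S (E z) \<bullet> S (E z) \<le> 2 * T * (z \<bullet> z) - z \<bullet> B z"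
      using R[of z] zBz[of z] by simp
    also have "\<dots> \<le> T ^ (2 * k) * (2 * T * (z0 \<bullet> z0) - z0 \<bullet> B z0)"
      unfolding z_def using T by (intro contraction_form_iterate[OF saB bound]) simp
    also have "\<dots> \<le> T ^ (2 * k) * (T\<^sup>2)\<^sup>2"
    proof (intro mult_left_mono)
      have "z0 \<bullet> z0 \<le> T"
        using mgf_one_step_le[OF \<alpha> r] by (simp add: z0_def self_adjointD(2)[OF saE] EE T_def)
      then have "2 * T * (z0 \<bullet> z0) \<le> 2 * T * T" using T by (intro mult_left_mono) auto
      moreover have "1 \<le> z0 \<bullet> B z0"
        using one_le_mgf_two_steps[of r] by (simp add: zBz z0_def EE)
      moreover have "2 * T * T - 1 \<le> (T\<^sup>2)\<^sup>2"
        using zero_le_power2[of "T\<^sup>2 - 1"] by (simp add: algebra_simps power2_eq_square)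
      ultimately show "2 * T * (z0 \<bullet> z0) - z0 \<bullet> B z0 \<le> (T\<^sup>2)\<^sup>2" by linarith
    qed (use T in auto)
    also have "\<dots> = (T ^ (k + 2))\<^sup>2"
      by (simp add: power_add power_mult_distrib power_mult[symmetric] mult.commute)
    finally show ?thesis .
  qed
  ultimately show ?thesis
    using T by (simp add: norm_eq_sqrt_inner real_le_lsqrt T_def \<alpha>_def)
qed

end

end

section \<open>Moment generating functions of a Markov chain\<close>

text \<open>The Markov property for a functional of the past: both expectations are finite sums over the possible
histories up to time \<open>m\<close>, and the conditional probabilities apply to each history of positive probability.\<close>

lemma markov_chain_step:
  fixes X :: "nat \<Rightarrow> 'a \<Rightarrow> 'v::finite" and G :: "(nat \<Rightarrow> 'v) \<Rightarrow> real"
  assumes chain: "markov_chain M X P q"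
    and G: "\<And>x y. (\<And>k. k \<le> m \<Longrightarrow> x k = y k) \<Longrightarrow> G x = G y"
  shows "(\<integral>\<omega>. G (\<lambda>k. X k \<omega>) * of_bool (X (Suc m) \<omega> = j) \<partial>M)
    = (\<Sum>i\<in>UNIV. P $ j $ i * (\<integral>\<omega>. G (\<lambda>k. X k \<omega>) * of_bool (X m \<omega> = i) \<partial>M))"
proof -
  interpret prob_space M using chain by (simp add: markov_chain_def)
  have X[measurable]: "X k \<in> measurable M (count_space UNIV)" for k
    using chain by (simp add: markov_chain_def)
  have P: "\<P>(\<omega> in M. X (Suc m) \<omega> = x (Suc m) \<and> (\<forall>k\<le>m. X k \<omega> = x k))
      = P $ x (Suc m) $ x m * \<P>(\<omega> in M. \<forall>k\<le>m. X k \<omega> = x k)" for x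
  proof (cases "0 < \<P>(\<omega> in M. \<forall>k\<le>m. X k \<omega> = x k)")
    case True
    then have "\<P>(\<omega> in M. X (Suc m) \<omega> = x (Suc m) \<bar> \<forall>k\<le>m. X k \<omega> = x k) = P $ x (Suc m) $ x m"
      using chain by (simp add: markov_chain_def)
    then show ?thesis using True by (simp add: cond_prob_def field_simps)
  next
    case False
    then have 0: "\<P>(\<omega> in M. \<forall>k\<le>m. X k \<omega> = x k) = 0"
      by (simp add: zero_less_measure_iff)
    have "\<P>(\<omega> in M. X (Suc m) \<omega> = x (Suc m) \<and> (\<forall>k\<le>m. X k \<omega> = x k))
        \<le> \<P>(\<omega> in M. \<forall>k\<le>m. X k \<omega> = x k)"
      by (rule finite_measure_mono) auto
    with 0 show ?thesis by (simp add: measure_le_0_iff)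
  qed
  define H where "H = (\<Pi>\<^sub>E k\<in>{..m}. (UNIV :: 'v set))"
  have fin: "finite H" unfolding H_def by (intro finite_PiE) auto
  have split: "G (\<lambda>k. X k \<omega>) * of_bool (Q \<omega>)
      = (\<Sum>x\<in>H. G x * indicator {\<omega>\<in>space M. Q \<omega> \<and> (\<forall>k\<le>m. X k \<omega> = x k)} \<omega>)"
    if "\<omega> \<in> space M" for \<omega> Q
  proof -
    define x0 where "x0 = restrict (\<lambda>k. X k \<omega>) {..m}"
    have x0: "x0 \<in> H" by (simp add: x0_def H_def)
    have "(\<forall>k\<le>m. X k \<omega> = x k) \<longleftrightarrow> x = x0" if "x \<in> H" for x
      using that by (auto simp: H_def x0_def PiE_iff extensional_def fun_eq_iff)
    then have "(\<Sum>x\<in>H. G x * indicator {\<omega>\<in>space M. Q \<omega> \<and> (\<forall>k\<le>m. X k \<omega> = x k)} \<omega>)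
        = (\<Sum>x\<in>H. if x = x0 then G x0 * of_bool (Q \<omega>) else 0)"
      using that by (intro sum.cong) (auto simp: indicator_def)
    also have "\<dots> = G x0 * of_bool (Q \<omega>)" using fin x0 by simp
    also have "G x0 = G (\<lambda>k. X k \<omega>)" by (rule G) (simp add: x0_def)
    finally show ?thesis by simp
  qed
  have integral: "(\<integral>\<omega>. G (\<lambda>k. X k \<omega>) * of_bool (Q \<omega>) \<partial>M)
      = (\<Sum>x\<in>H. G x * \<P>(\<omega> in M. Q \<omega> \<and> (\<forall>k\<le>m. X k \<omega> = x k)))"
    if [measurable]: "Measurable.pred M Q" for Q
  proof -
    have "(\<integral>\<omega>. G (\<lambda>k. X k \<omega>) * of_bool (Q \<omega>) \<partial>M)
      = (\<integral>\<omega>. (\<Sum>x\<in>H. G x * indicator {\<omega>\<in>space M. Q \<omega> \<and> (\<forall>k\<le>m. X k \<omega> = x k)} \<omega>) \<partial>M)"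
      using split by (intro Bochner_Integration.integral_cong) auto
    also have "\<dots> = (\<Sum>x\<in>H. G x * \<P>(\<omega> in M. Q \<omega> \<and> (\<forall>k\<le>m. X k \<omega> = x k)))"
      by (subst Bochner_Integration.integral_sum) (auto intro!: integrable_real_indicator simp: emeasure_eq_measure)
    finally show ?thesis .
  qed
  have "(\<integral>\<omega>. G (\<lambda>k. X k \<omega>) * of_bool (X (Suc m) \<omega> = j) \<partial>M)
      = (\<Sum>x\<in>H. G x * \<P>(\<omega> in M. X (Suc m) \<omega> = j \<and> (\<forall>k\<le>m. X k \<omega> = x k)))"
    by (rule integral) measurable
  also have "\<dots> = (\<Sum>x\<in>H. G x * (P $ j $ x m * \<P>(\<omega> in M. \<forall>k\<le>m. X k \<omega> = x k)))"
  proof (intro sum.cong refl arg_cong[where f = "(*) _"])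
    fix x
    have "(\<forall>k\<le>m. X k \<omega> = (x(Suc m := j)) k) \<longleftrightarrow> (\<forall>k\<le>m. X k \<omega> = x k)" for \<omega> by simp
    then show "\<P>(\<omega> in M. X (Suc m) \<omega> = j \<and> (\<forall>k\<le>m. X k \<omega> = x k))
        = P $ j $ x m * \<P>(\<omega> in M. \<forall>k\<le>m. X k \<omega> = x k)"
      using P[of "x(Suc m := j)"] by simp
  qed
  also have "\<dots> = (\<Sum>x\<in>H. \<Sum>i\<in>UNIV. P $ j $ i * (G x * \<P>(\<omega> in M. X m \<omega> = i \<and> (\<forall>k\<le>m. X k \<omega> = x k))))"
  proof (intro sum.cong refl)
    fix x
    have "\<P>(\<omega> in M. X m \<omega> = i \<and> (\<forall>k\<le>m. X k \<omega> = x k))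
        = (if i = x m then \<P>(\<omega> in M. \<forall>k\<le>m. X k \<omega> = x k) else 0)" for i
    proof (cases "i = x m")
      case True
      then show ?thesis by (auto intro!: arg_cong[where f = "measure M"])
    next
      case False
      then have "{\<omega> \<in> space M. X m \<omega> = i \<and> (\<forall>k\<le>m. X k \<omega> = x k)} = {}" by auto
      with False show ?thesis by (simp only: measure_empty if_False)
    qed
    then show "G x * (P $ j $ x m * \<P>(\<omega> in M. \<forall>k\<le>m. X k \<omega> = x k))
        = (\<Sum>i\<in>UNIV. P $ j $ i * (G x * \<P>(\<omega> in M. X m \<omega> = i \<and> (\<forall>k\<le>m. X k \<omega> = x k))))"
      by (simp add: if_distrib[of "\<lambda>z. _ * z"] cong: if_cong)
  qed
  also have "\<dots> = (\<Sum>i\<in>UNIV. P $ j $ i * (\<Sum>x\<in>H. G x * \<P>(\<omega> in M. X m \<omega> = i \<and> (\<forall>k\<le>m. X k \<omega> = x k))))"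
    by (subst sum.swap) (simp add: sum_distrib_left)
  also have "\<dots> = (\<Sum>i\<in>UNIV. P $ j $ i * (\<integral>\<omega>. G (\<lambda>k. X k \<omega>) * of_bool (X m \<omega> = i) \<partial>M))"
    by (intro sum.cong refl arg_cong[where f = "(*) _"] integral[symmetric]) measurable
  finally show ?thesis .
qed

context reversible_chain
begin

text \<open>The weights \<open>W m i\<close>, the expectation of \<open>exp (r * S_m)\<close> on the event \<open>X m = i\<close>, satisfy a linear
recursion; divided by \<open>sqrt s\<close> they evolve under \<open>S\<close> followed by the tilt, and taking adjoints moves
the evolution to the other side of the inner product.\<close>

lemma mgf_eq_tilted_power:
  assumes chain: "markov_chain M X P q"
  shows "(\<integral>\<omega>. exp (r * (\<Sum>i=1..n. f (X i \<omega>))) \<partial>M)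
    = (\<chi> i. q $ i / sqrt (s $ i)) \<bullet> ((\<lambda>x. S (tilt f r x)) ^^ n) sqrt_s"
proof -
  interpret prob_space M using chain by (simp add: markov_chain_def)
  have X[measurable]: "X k \<in> measurable M (count_space UNIV)" for k
    using chain by (simp add: markov_chain_def)
  have [measurable]: "(\<lambda>\<omega>. f (X k \<omega>)) \<in> borel_measurable M" for k
    by (rule measurable_compose[OF X]) simp
  define Z where "Z m x = exp (r * (\<Sum>k=1..m. f (x k)))" for m and x :: "nat \<Rightarrow> 'v"
  define W where "W m i = (\<integral>\<omega>. Z m (\<lambda>k. X k \<omega>) * of_bool (X m \<omega> = i) \<partial>M)" for m i
  define U where "U m = (\<chi> i. W m i / sqrt (s $ i))" for m
  have W_Suc: "W (Suc m) j = exp (r * f j) * (\<Sum>i\<in>UNIV. P $ j $ i * W m i)" for m j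
  proof -
    have "W (Suc m) j = (\<integral>\<omega>. exp (r * f j) * (Z m (\<lambda>k. X k \<omega>) * of_bool (X (Suc m) \<omega> = j)) \<partial>M)"
      unfolding W_def by (intro Bochner_Integration.integral_cong) (auto simp: Z_def distrib_left exp_add)
    also have "\<dots> = exp (r * f j) * (\<integral>\<omega>. Z m (\<lambda>k. X k \<omega>) * of_bool (X (Suc m) \<omega> = j) \<partial>M)"
      by simp
    also have "(\<integral>\<omega>. Z m (\<lambda>k. X k \<omega>) * of_bool (X (Suc m) \<omega> = j) \<partial>M) = (\<Sum>i\<in>UNIV. P $ j $ i * W m i)"
      unfolding W_def by (rule markov_chain_step[OF chain]) (simp add: Z_def)
    finally show ?thesis .
  qed
  have "U (Suc m) = tilt f r (S (U m))" for m
    by (simp add: U_def S_def tilt_def vec_eq_iff W_Suc sum_divide_distrib flip: times_divide_eq_right)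
      (simp add: sum_divide_distrib)
  then have step: "U (Suc m) \<bullet> y = U m \<bullet> S (tilt f r y)" for m y
    by (simp add: self_adjointD(2)[OF self_adjoint_tilt] self_adjointD(2)[OF self_adjoint_S])
  have inner_U: "U m \<bullet> y = U 0 \<bullet> ((\<lambda>x. S (tilt f r x)) ^^ m) y" for m y
    by (induction m arbitrary: y) (simp_all add: step funpow_swap1[of "\<lambda>x. S (tilt f r x)"])
  have "W 0 i = q $ i" for i
  proof -
    have "W 0 i = (\<integral>\<omega>. indicator {\<omega>\<in>space M. X 0 \<omega> = i} \<omega> \<partial>M)"
      unfolding W_def by (intro Bochner_Integration.integral_cong) (auto simp: Z_def)
    then show ?thesis using chain by (simp add: markov_chain_def)
  qed
  then have U0: "U 0 = (\<chi> i. q $ i / sqrt (s $ i))" by (simp add: U_def)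
  have "(\<integral>\<omega>. exp (r * (\<Sum>i=1..n. f (X i \<omega>))) \<partial>M) = (\<Sum>i\<in>UNIV. W n i)"
  proof -
    have int: "integrable M (\<lambda>\<omega>. Z n (\<lambda>k. X k \<omega>) * of_bool (X n \<omega> = i))" for i
    proof (rule integrable_const_bound)
      define b where "b = exp (\<bar>r\<bar> * (\<Sum>k=1..n. Max (range (\<lambda>i. \<bar>f i\<bar>))))"
      have "Z n (\<lambda>k. X k \<omega>) \<le> b" for \<omega>
      proof -
        have "r * (\<Sum>k=1..n. f (X k \<omega>)) \<le> \<bar>r\<bar> * \<bar>\<Sum>k=1..n. f (X k \<omega>)\<bar>"
          by (metis abs_ge_self abs_mult)
        also have "\<dots> \<le> \<bar>r\<bar> * (\<Sum>k=1..n. \<bar>f (X k \<omega>)\<bar>)"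
          by (intro mult_left_mono sum_abs) auto
        also have "\<dots> \<le> \<bar>r\<bar> * (\<Sum>k=1..n. Max (range (\<lambda>i. \<bar>f i\<bar>)))"
          by (intro mult_left_mono sum_mono Max_ge) auto
        finally show ?thesis by (simp add: Z_def b_def)
      qed
      then show "AE \<omega> in M. norm (Z n (\<lambda>k. X k \<omega>) * of_bool (X n \<omega> = i)) \<le> b"
        by (auto simp: Z_def b_def)
    qed (simp add: Z_def, measurable)
    have "(\<Sum>i\<in>UNIV. W n i) = (\<integral>\<omega>. (\<Sum>i\<in>UNIV. Z n (\<lambda>k. X k \<omega>) * of_bool (X n \<omega> = i)) \<partial>M)"
      unfolding W_def by (rule Bochner_Integration.integral_sum[symmetric]) (rule int)
    also have "\<dots> = (\<integral>\<omega>. Z n (\<lambda>k. X k \<omega>) \<partial>M)"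
      by (intro Bochner_Integration.integral_cong) (simp_all flip: sum_distrib_left)
    finally show ?thesis by (simp add: Z_def)
  qed
  also have "\<dots> = U n \<bullet> sqrt_s"
    by (simp add: U_def sqrt_s_def inner_vec_def)
  finally show ?thesis by (simp add: inner_U[of n] U0)
qed

lemma chernoff_bound:
  assumes chain: "markov_chain M X P q" and r: "0 < r" and n: "1 \<le> n"
  shows "\<P>(\<omega> in M. 1 / real n * (\<Sum>i=1..n. f (X i \<omega>)) > \<gamma>)
    \<le> exp (- (r * \<gamma> * real n)) * (norm (\<chi> i. q $ i / sqrt (s $ i))
      * norm (((\<lambda>x. S (tilt f r x)) ^^ n) sqrt_s))"
proof -
  interpret prob_space M using chain by (simp add: markov_chain_def)
  have X[measurable]: "X k \<in> measurable M (count_space UNIV)" for k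
    using chain by (simp add: markov_chain_def)
  have [measurable]: "(\<lambda>\<omega>. f (X k \<omega>)) \<in> borel_measurable M" for k
    by (rule measurable_compose[OF X]) simp
  define Z where "Z \<omega> = exp (r * (\<Sum>i=1..n. f (X i \<omega>)))" for \<omega>
  have Z_bounded: "Z \<omega> \<le> exp (r * (\<Sum>i=1..n. Max (range f)))" for \<omega>
    unfolding Z_def exp_le_cancel_iff using r by (intro mult_left_mono sum_mono Max_ge) auto
  have int: "integrable M Z"
    by (rule integrable_const_bound[where B = "exp (r * (\<Sum>i=1..n. Max (range f)))"])
      (use Z_bounded in \<open>auto simp: Z_def[abs_def]\<close>)
  have "\<P>(\<omega> in M. 1 / real n * (\<Sum>i=1..n. f (X i \<omega>)) > \<gamma>)
      \<le> \<P>(\<omega> in M. exp (r * \<gamma> * real n) \<le> Z \<omega>)"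
  proof (rule finite_measure_mono)
    show "{\<omega> \<in> space M. \<gamma> < 1 / real n * (\<Sum>i=1..n. f (X i \<omega>))}
        \<subseteq> {\<omega> \<in> space M. exp (r * \<gamma> * real n) \<le> Z \<omega>}"
      using r n by (auto simp: Z_def field_simps)
  qed (simp add: Z_def, measurable)
  also have "\<dots> \<le> (\<integral>\<omega>. Z \<omega> \<partial>M) / exp (r * \<gamma> * real n)"
    by (rule integral_Markov_inequality_measure[OF int sets.top]) (auto simp: Z_def)
  also have "(\<integral>\<omega>. Z \<omega> \<partial>M) \<le> norm (\<chi> i. q $ i / sqrt (s $ i))
      * norm (((\<lambda>x. S (tilt f r x)) ^^ n) sqrt_s)"
    unfolding Z_def mgf_eq_tilted_power[OF chain] by (rule norm_cauchy_schwarz)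
  finally show ?thesis by (simp add: exp_minus field_simps)
qed

lemma one_le_norm_initial:
  assumes "prob_vector q"
  shows "1 \<le> norm (\<chi> i. q $ i / sqrt (s $ i))"
proof -
  have "(\<chi> i. q $ i / sqrt (s $ i)) \<bullet> sqrt_s = 1"
    using assms by (simp add: inner_vec_def sqrt_s_def prob_vector_def)
  then show ?thesis
    using norm_cauchy_schwarz[of "\<chi> i. q $ i / sqrt (s $ i)" sqrt_s] sqrt_s_unit
    by (simp add: norm_eq_sqrt_inner)
qed

end

section \<open>Random walks on connected weighted graphs\<close>

text \<open>The maximum principle: a weighted average equal to the maximum forces all neighbours to attain it.\<close>

lemma connected_harmonic_const:
  fixes w :: "'v::finite \<Rightarrow> 'v \<Rightarrow> real"
  assumes w: "connected_weighted_graph w"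
    and harmonic: "\<And>i. (\<Sum>j\<in>UNIV. w i j * h j) = degree_weight w i * h i"
  shows "h i = h j"
proof -
  have "Max (range h) \<in> range h" by (rule Max_in) auto
  then obtain m where "Max (range h) = h m" by (rule imageE)
  then have m: "h k \<le> h m" for k using Max_ge[of "range h" "h k"] by simp
  have "h k = h m" for k
  proof -
    have "(\<lambda>u v. 0 < w u v)\<^sup>*\<^sup>* m k" using w by (simp add: connected_weighted_graph_def)
    then show ?thesis
    proof induction
      case (step u v)
      have "(\<Sum>j\<in>UNIV. w u j * (h u - h j)) = 0"
        using harmonic[of u]
        by (simp add: degree_weight_def right_diff_distrib sum_subtractf sum_distrib_right)
      moreover have "0 \<le> w u j * (h u - h j)" for j
        using w m[of j] step.IH by (simp add: connected_weighted_graph_def)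
      ultimately have "w u v * (h u - h v) = 0"
        by (simp add: sum_nonneg_eq_0_iff)
      then show ?case using step by simp
    qed simp
  qed
  then show ?thesis by metis
qed

text \<open>The ratio of \<open>s\<close> to the degree is harmonic for the walk, hence constant, and then detailed balance is
the symmetry of the weights. A vertex of degree 0 would lose the mass that \<open>s\<close> puts there.\<close>

lemma reversible_chain_walk_matrix:
  assumes w: "connected_weighted_graph w" and stat: "stationary_distribution (walk_matrix w) s"
  shows "reversible_chain (walk_matrix w) s"
proof -
  define P d where "P = walk_matrix w" and "d = degree_weight w"
  have w0: "0 \<le> w i j" and w_sym: "w i j = w j i" for i j
    using w by (auto simp: connected_weighted_graph_def)
  have d0: "0 \<le> d i" for i unfolding d_def degree_weight_def by (intro sum_nonneg w0)
  have P: "P $ i $ j = w j i / d j" for i j by (simp add: P_def walk_matrix_def d_def)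
  have P0: "0 \<le> P $ i $ j" for i j by (simp add: P w0 d0)
  have s0: "0 \<le> s $ i" and s1: "(\<Sum>i\<in>UNIV. s $ i) = 1"
    and Ps: "(\<Sum>j\<in>UNIV. P $ i $ j * s $ j) = s $ i" for i
    using stat by (auto simp: stationary_distribution_def prob_vector_def P_def matrix_vector_mult_def vec_eq_iff)
  have d_pos: "0 < d u" if "0 < w u v" for u v
  proof -
    have "w u v \<le> d u" unfolding d_def degree_weight_def by (intro member_le_sum) (auto simp: w0)
    then show ?thesis using that by simp
  qed
  have s_pos: "0 < s $ i" for i
  proof -
    obtain m where m: "0 < s $ m"
      using s0 s1 by (metis less_eq_real_def sum.neutral zero_neq_one)
    have "(\<lambda>u v. 0 < w u v)\<^sup>*\<^sup>* m i" using w by (simp add: connected_weighted_graph_def)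
    then show ?thesis
    proof induction
      case (step u v)
      have "0 < P $ v $ u * s $ u" using step d_pos[of u v] by (simp add: P)
      also have "\<dots> \<le> (\<Sum>j\<in>UNIV. P $ v $ j * s $ j)"
        by (intro member_le_sum) (auto simp: P0 s0)
      finally show ?case by (simp add: Ps)
    qed (rule m)
  qed
  have P_col': "(\<Sum>i\<in>UNIV. P $ i $ j) = (if d j = 0 then 0 else 1)" for j
    by (simp add: P flip: sum_divide_distrib) (simp add: d_def degree_weight_def)
  have d_nz: "d j \<noteq> 0" for j
  proof
    assume dj: "d j = 0"
    have "1 = (\<Sum>i\<in>UNIV. \<Sum>k\<in>UNIV. P $ i $ k * s $ k)" by (simp add: Ps s1)
    also have "\<dots> = (\<Sum>k\<in>UNIV. (\<Sum>i\<in>UNIV. P $ i $ k) * s $ k)"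
      by (subst sum.swap) (simp add: sum_distrib_right)
    also have "\<dots> < (\<Sum>k\<in>UNIV. s $ k)"
      by (rule sum_strict_mono_ex1) (use s0 s_pos[of j] dj in \<open>auto simp: P_col'\<close>)
    finally show False using s1 by simp
  qed
  have const: "h i = h j" if "\<And>i. (\<Sum>j\<in>UNIV. w i j * h j) = d i * h i" for h i j
    using connected_harmonic_const[OF w] that by (simp add: d_def)
  have ratio: "s $ i / d i = s $ j / d j" for i j
  proof (rule const)
    show "(\<Sum>j\<in>UNIV. w i j * (s $ j / d j)) = d i * (s $ i / d i)" for i
      using Ps[of i] d_nz[of i] by (simp add: P w_sym[of i])
  qed
  have "reversible_chain P s"
  proof
    show "s $ j * P $ i $ j = s $ i * P $ j $ i" for i j
      using ratio[of i j] w_sym[of i j] by (simp add: P) (metis mult.commute times_divide_eq_left)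
    fix h i j assume harmonic: "\<And>i. (\<Sum>j\<in>UNIV. P $ j $ i * h j) = h i"
    show "h i = h j"
    proof (rule const)
      fix i show "(\<Sum>j\<in>UNIV. w i j * h j) = d i * h i"
        using harmonic[of i] d_nz[of i] by (simp add: P field_simps flip: sum_divide_distrib)
    qed
  qed (use s_pos s1 P0 P_col' d_nz in auto)
  then show ?thesis by (simp add: P_def)
qed

section \<open>Tail bounds\<close>

text \<open>The usual Bernstein choice of \<open>r\<close>: here \<open>c - r = c * V / (V + \<gamma>)\<close>, so that the rate is exactly
\<open>exp (r * \<gamma> / 2)\<close>, half of the Chernoff gain in the exponent.\<close>

lemma bernstein_rate_optimum:
  assumes \<alpha>: "0 \<le> \<alpha>" "\<alpha> < 1" and V: "0 < V" and \<gamma>: "0 < \<gamma>"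
    and c: "c = (1 - \<alpha>) / (1 + \<alpha>)" and r: "r = c * \<gamma> / (V + \<gamma>)"
  shows "0 < r" "r < c" "bernstein_rate \<alpha> V r = exp (c * (\<gamma>\<^sup>2 / (2 * (V + \<gamma>))))"
proof -
  have c0: "0 < c" using \<alpha> by (simp add: c)
  show "0 < r" using c0 V \<gamma> by (simp add: r)
  have cr: "c - r = c * V / (V + \<gamma>)" using V \<gamma> by (simp add: r field_simps)
  moreover have "0 < c * V / (V + \<gamma>)" using c0 V \<gamma> by simp
  ultimately show "r < c" by simp
  have "V * ((c * \<gamma> / D)\<^sup>2 / (2 * (c * V / D))) = c * (\<gamma>\<^sup>2 / (2 * D))" if "0 < D" for D
    using that c0 V by (simp add: field_simps power2_eq_square)
  then have "V * (r\<^sup>2 / (2 * (c - r))) = c * (\<gamma>\<^sup>2 / (2 * (V + \<gamma>)))"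
    unfolding cr unfolding r using V \<gamma> by simp
  then show "bernstein_rate \<alpha> V r = exp (c * (\<gamma>\<^sup>2 / (2 * (V + \<gamma>))))"
    by (simp add: bernstein_rate_def c)
qed

theorem corollary3:
  fixes w :: "'v::finite \<Rightarrow> 'v \<Rightarrow> real"
    and P :: "real^'v^'v"
    and s q :: "real^'v"
    and f :: "'v \<Rightarrow> real"
    and \<alpha> \<beta> V \<gamma> :: real
    and M :: "'a measure"
    and X :: "nat \<Rightarrow> 'a \<Rightarrow> 'v"
    and n :: nat
  assumes graph: "connected_weighted_graph w"
    and P_def: "P = walk_matrix w"
    and stationary: "stationary_distribution P s"
    and \<alpha>_def: "\<alpha> = spec_alpha P"
    and \<beta>_def: "\<beta> = spec_beta P"
    and f_max: "(MAX i. \<bar>f i\<bar>) = 1"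
    and f_mean: "(\<Sum>i\<in>UNIV. f i * s $ i) = 0"
    and V_def: "V = (\<Sum>i\<in>UNIV. (f i)\<^sup>2 * s $ i)"
    and q: "prob_vector q"
    and chain: "markov_chain M X P q"
    and n: "n \<ge> 1"
    and \<gamma>: "\<gamma> > 0"
  shows "\<P>(\<omega> in M. 1 / real n * (\<Sum>i=1..n. f (X i \<omega>)) > \<gamma>)
           \<le> norm (\<chi> i. q $ i / sqrt (s $ i)) *
             exp (- real n * ((1 - \<beta>\<^sup>2) / (1 + \<beta>\<^sup>2)) * (\<gamma>\<^sup>2 / (4 * (V + \<gamma>)))) \<and>
         \<P>(\<omega> in M. 1 / real n * (\<Sum>i=1..n. f (X i \<omega>)) > \<gamma>)
           \<le> exp ((1 - \<alpha>) / (1 + \<alpha>) * (\<gamma>\<^sup>2 / (V + \<gamma>))) *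
             norm (\<chi> i. q $ i / sqrt (s $ i)) *
             exp (- real n * ((1 - \<alpha>) / (1 + \<alpha>)) * (\<gamma>\<^sup>2 / (2 * (V + \<gamma>))))"
proof -
  interpret reversible_chain P s
    unfolding P_def by (rule reversible_chain_walk_matrix[OF graph stationary[unfolded P_def]])
  interpret prob_space M using chain by (simp add: markov_chain_def)
  have f_le: "f i \<le> 1" for i
    using Max_ge[of "range (\<lambda>i. \<bar>f i\<bar>)" "\<bar>f i\<bar>"] f_max by auto
  have "1 \<in> range (\<lambda>i. \<bar>f i\<bar>)"
    unfolding f_max[symmetric] by (rule Max_in) auto
  then obtain i0 where i0: "f i0 \<noteq> 0" by fastforce
  have V: "0 < V"
    unfolding V_def by (rule sum_pos2[of UNIV i0]) (use i0 s_pos in \<open>auto simp: less_imp_le\<close>)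
  define u where "u = norm (\<chi> i. q $ i / sqrt (s $ i))"
  have u: "1 \<le> u" unfolding u_def by (rule one_le_norm_initial[OF q])
  \<comment> \<open>\<open>f * sqrt s\<close> is a nonzero vector orthogonal to \<open>sqrt_s\<close>, so \<open>\<beta>\<close> is the maximum of a nonempty set\<close>
  define x0 where "x0 = (\<chi> i. f i * sqrt (s $ i))"
  have "sqrt_s \<bullet> x0 = (\<Sum>i\<in>UNIV. f i * s $ i)"
    unfolding x0_def sqrt_s_def inner_vec_def by (intro sum.cong) (auto simp: mult.left_commute)
  moreover have "x0 \<noteq> 0" using i0 by (auto simp: x0_def vec_eq_iff)
  ultimately have "eigenvalues P - {1} \<noteq> {}"
    using f_mean by (intro exists_nontrivial_eigenvalue) auto
  then have \<beta>: "0 \<le> \<beta>" "\<beta> \<le> 1" using spec_beta_bounds(2) by (auto simp: \<beta>_def)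
  have \<alpha>: "0 \<le> \<alpha>" "\<alpha> < 1" unfolding \<alpha>_def by (rule spec_alpha_bounds)+
  let ?p = "\<P>(\<omega> in M. 1 / real n * (\<Sum>i=1..n. f (X i \<omega>)) > \<gamma>)"

  have "?p \<le> u * exp (- real n * ((1 - \<beta>\<^sup>2) / (1 + \<beta>\<^sup>2)) * (\<gamma>\<^sup>2 / (4 * (V + \<gamma>))))"
  proof (cases "\<beta> = 1")
    case True
    \<comment> \<open>the exponential factor is then 1, and \<open>1 \<le> u\<close>\<close>
    then show ?thesis using u order_trans[OF prob_le_1] by simp
  next
    case False
    with \<beta> have \<beta>1: "0 \<le> \<beta>\<^sup>2" "\<beta>\<^sup>2 < 1" "\<beta> < 1" by (auto simp: abs_square_less_1)
    define c r x where "c = (1 - \<beta>\<^sup>2) / (1 + \<beta>\<^sup>2)" and "r = c * \<gamma> / (V + \<gamma>) / 2"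
      and "x = c * (\<gamma>\<^sup>2 / (2 * (V + \<gamma>)))"
    have "2 * r = c * \<gamma> / (V + \<gamma>)" by (simp only: r_def mult_2 field_sum_of_halves)
    from bernstein_rate_optimum[OF \<beta>1(1,2) V \<gamma> c_def this]
    have r: "0 < r" "2 * r < c" and rate: "bernstein_rate (\<beta>\<^sup>2) V (2 * r) = exp x"
      by (simp_all add: x_def)
    have r\<gamma>: "r * \<gamma> = x" by (simp add: r_def x_def power2_eq_square mult_ac)
    define N where "N = norm (((\<lambda>x. S (tilt f r x)) ^^ n) sqrt_s)"
    have "N\<^sup>2 \<le> exp x ^ n"
      unfolding N_def rate[symmetric] unfolding \<beta>_def
      by (rule norm_tilted_power_le_spec_beta[OF f_le f_mean V_def])
        (use \<beta> \<beta>1 r in \<open>auto simp: \<beta>_def c_def\<close>)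
    also have "\<dots> = (exp (real n * x / 2))\<^sup>2"
      by (simp flip: exp_of_nat_mult)
    finally have N: "N \<le> exp (real n * x / 2)" by (rule power2_le_imp_le) simp
    have "?p \<le> exp (- (r * \<gamma> * real n)) * (u * N)"
      unfolding u_def N_def by (rule chernoff_bound[OF chain r(1) n])
    also have "\<dots> \<le> exp (- (x * real n)) * (u * exp (real n * x / 2))"
      unfolding r\<gamma> using N u by (intro mult_left_mono) auto
    also have "\<dots> = u * exp (- (x * real n) + real n * x / 2)"
      by (simp only: exp_add mult_ac)
    also have "- (x * real n) + real n * x / 2 = - real n * c * (\<gamma>\<^sup>2 / (4 * (V + \<gamma>)))"
    proof -
      define y where "y = \<gamma>\<^sup>2 / (4 * (V + \<gamma>))"
      have "\<gamma>\<^sup>2 / (2 * D) = 2 * (\<gamma>\<^sup>2 / (4 * D))" for D by simp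
      then have "x = c * (2 * y)" by (simp only: x_def y_def)
      then show ?thesis unfolding y_def[symmetric] by (simp add: mult_ac)
    qed
    finally show ?thesis by (simp add: c_def)
  qed
  moreover have "?p \<le> exp ((1 - \<alpha>) / (1 + \<alpha>) * (\<gamma>\<^sup>2 / (V + \<gamma>))) * u *
      exp (- real n * ((1 - \<alpha>) / (1 + \<alpha>)) * (\<gamma>\<^sup>2 / (2 * (V + \<gamma>))))"
  proof -
    define c r x where "c = (1 - \<alpha>) / (1 + \<alpha>)" and "r = c * \<gamma> / (V + \<gamma>)"
      and "x = c * (\<gamma>\<^sup>2 / (2 * (V + \<gamma>)))"
    have r: "0 < r" "r < c" and rate: "bernstein_rate \<alpha> V r = exp x"
      using bernstein_rate_optimum[OF \<alpha> V \<gamma> c_def r_def] by (simp_all add: x_def)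
    have r\<gamma>: "r * \<gamma> = 2 * x" using V \<gamma> by (simp add: r_def x_def power2_eq_square field_simps)
    have x0: "0 \<le> x" using \<alpha> V \<gamma> by (simp add: x_def c_def)
    obtain k where k: "n = Suc k" using n by (cases n) auto
    define N where "N = norm (((\<lambda>x. S (tilt f r x)) ^^ n) sqrt_s)"
    have "N \<le> bernstein_rate (spec_alpha P) V r ^ (k + 2)"
      unfolding N_def k
      by (rule norm_tilted_power_le_spec_alpha[OF f_le f_mean V_def])
        (use r in \<open>auto simp: \<alpha>_def c_def\<close>)
    also have "\<dots> = exp (real (n + 1) * x)"
      unfolding \<alpha>_def[symmetric] rate k by (simp only: exp_of_nat_mult[symmetric]) simp
    finally have N: "N \<le> exp (real (n + 1) * x)" .
    have "?p \<le> exp (- (r * \<gamma> * real n)) * (u * N)"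
      unfolding u_def N_def by (rule chernoff_bound[OF chain r(1) n])
    also have "\<dots> \<le> exp (- (2 * x * real n)) * (u * exp (real (n + 1) * x))"
      unfolding r\<gamma> using N u by (intro mult_left_mono) auto
    also have "\<dots> = u * exp (x - real n * x)"
      by (simp add: algebra_simps flip: exp_add)
    also have "\<dots> \<le> u * exp (2 * x + - real n * c * (\<gamma>\<^sup>2 / (2 * (V + \<gamma>))))"
    proof -
      have "x - real n * x \<le> 2 * x + - real n * c * (\<gamma>\<^sup>2 / (2 * (V + \<gamma>)))"
        unfolding mult.assoc x_def[symmetric] using x0 by simp
      then show ?thesis using u by (intro mult_left_mono) auto
    qed
    also have "\<dots> = exp (c * (\<gamma>\<^sup>2 / (V + \<gamma>))) * u * exp (- real n * c * (\<gamma>\<^sup>2 / (2 * (V + \<gamma>))))"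
    proof -
      have "2 * x = c * (\<gamma>\<^sup>2 / (V + \<gamma>))" using V \<gamma> by (simp add: x_def field_simps)
      then show ?thesis by (simp only: exp_add mult_ac)
    qed
    finally show ?thesis by (simp add: c_def)
  qed
  ultimately show ?thesis by (simp add: u_def)
qed

end
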